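(* Let $G$ be a finite simple graph with three distinct vertices $i,j,k$ that are pairwise cospectral, and assume there is a cut-vertex $v$ of $G$ such that $i$, $j$ and $k$ lie in three distinct connected components of $G\setminus v$. Then at least one of the pairs $\{i,j\}$, $\{i,k\}$, $\{j,k\}$ is not strongly cospectral.
   Context: For a graph $H$, $\phi^H$ denotes the characteristic polynomial (in the variable $t$) of its adjacency matrix; $H\setminus S$ denotes the graph obtained by deleting the vertex set $S$. Two vertices $a,b$ of $G$ are cospectral if $\phi^{G\setminus a}=\phi^{G\setminus b}$. Let $A=\sum_r\theta_rE_r$ be the spectral decomposition of the adjacency matrix of $G$ ($\theta_r$ the distinct eigenvalues, $E_r$ the orthogonal projection onto the $\theta_r$-eigenspace); vertices $a,b$ are strongly cospectral if $E_re_a=\pm E_re_b$ for every $r$, where $e_a$ is the characteristic vector of $a$. *)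

theory Defs
  imports "Graph_Theory.Digraph_Component" "Jordan_Normal_Form.Char_Poly"
begin

text \<open>
  A finite simple graph is a digraph \<open>G\<close> with \<open>graph G\<close>: finite, symmetric, without loops and
  without multiple arcs, so each edge is a pair of opposite arcs. For such a digraph the strongly
  connected components (\<^const>\<open>pre_digraph.sccs\<close>) are the connected components of the graph.
\<close>

definition adj_matrix :: "('a, 'b) pre_digraph \<Rightarrow> 'a list \<Rightarrow> real mat" where
  "adj_matrix G xs =
     mat (length xs) (length xs) (\<lambda>(m, l). if xs ! m \<rightarrow>\<^bsub>G\<^esub> xs ! l then 1 else 0)"

definition char_vec :: "'a list \<Rightarrow> 'a \<Rightarrow> real vec" where
  "char_vec xs a = vec (length xs) (\<lambda>m. if xs ! m = a then 1 else 0)"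

definition vertex_list :: "('a, 'b) pre_digraph \<Rightarrow> 'a list" where
  "vertex_list G = (SOME xs. distinct xs \<and> set xs = verts G)"

definition graph_char_poly :: "('a, 'b) pre_digraph \<Rightarrow> real poly" where
  "graph_char_poly G = char_poly (adj_matrix G (vertex_list G))"

definition cospectral :: "('a, 'b) pre_digraph \<Rightarrow> 'a \<Rightarrow> 'a \<Rightarrow> bool" where
  "cospectral G a b \<longleftrightarrow>
     graph_char_poly (pre_digraph.del_vert G a) = graph_char_poly (pre_digraph.del_vert G b)"

definition eigenspace :: "real mat \<Rightarrow> real \<Rightarrow> real vec set" where
  "eigenspace A \<theta> = {x \<in> carrier_vec (dim_row A). A *\<^sub>v x = \<theta> \<cdot>\<^sub>v x}"

definition is_orth_proj :: "nat \<Rightarrow> real vec set \<Rightarrow> real mat \<Rightarrow> bool" where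
  "is_orth_proj n W P \<longleftrightarrow> P \<in> carrier_mat n n \<and>
     (\<forall>x \<in> carrier_vec n. P *\<^sub>v x \<in> W \<and> (\<forall>w \<in> W. (x - P *\<^sub>v x) \<bullet> w = 0))"

definition eigenprojection :: "real mat \<Rightarrow> real \<Rightarrow> real mat" where
  "eigenprojection A \<theta> = (THE P. is_orth_proj (dim_row A) (eigenspace A \<theta>) P)"

definition strongly_cospectral :: "('a, 'b) pre_digraph \<Rightarrow> 'a \<Rightarrow> 'a \<Rightarrow> bool" where
  "strongly_cospectral G a b \<longleftrightarrow>
     (let xs = vertex_list G; A = adj_matrix G xs
      in \<forall>\<theta>. eigenvalue A \<theta> \<longrightarrow>
           eigenprojection A \<theta> *\<^sub>v char_vec xs a = eigenprojection A \<theta> *\<^sub>v char_vec xs b \<or>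
           eigenprojection A \<theta> *\<^sub>v char_vec xs a = - (eigenprojection A \<theta> *\<^sub>v char_vec xs b))"

definition cut_vertex :: "('a, 'b) pre_digraph \<Rightarrow> 'a \<Rightarrow> bool" where
  "cut_vertex G v \<longleftrightarrow> v \<in> verts G \<and>
     card (pre_digraph.sccs G) < card (pre_digraph.sccs (pre_digraph.del_vert G v))"

text \<open>The characteristic polynomial does not depend on the chosen enumeration of the vertices.\<close>

lemma vertex_list:
  assumes "finite (verts G)"
  shows "distinct (vertex_list G)" "set (vertex_list G) = verts G"
proof -
  obtain xs where "distinct xs \<and> set xs = verts G"
    using finite_distinct_list[OF assms] by blast
  then have "distinct (vertex_list G) \<and> set (vertex_list G) = verts G"
    unfolding vertex_list_def by (rule someI)
  then show "distinct (vertex_list G)" "set (vertex_list G) = verts G" by auto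
qed

lemma det_permute_both:
  fixes M :: "'c :: comm_ring_1 mat"
  assumes M: "M \<in> carrier_mat n n" and p: "p permutes {0..<n}"
  shows "det (mat n n (\<lambda>(i, j). M $$ (p i, p j))) = det M"
proof -
  let ?N = "transpose_mat (mat n n (\<lambda>(i, j). M $$ (p i, j)))"
  have lt: "p i < n" if "i < n" for i using permutes_in_image[OF p, of i] that by auto
  have N: "?N \<in> carrier_mat n n" by auto
  have s: "signof p * (signof p * c) = (c :: 'c)" for c
    by (auto simp: sign_def)
  have "mat n n (\<lambda>(i, j). M $$ (p i, p j)) = transpose_mat (mat n n (\<lambda>(i, j). ?N $$ (p i, j)))"
    using lt by (intro eq_matI) auto
  also have "det \<dots> = det (mat n n (\<lambda>(i, j). ?N $$ (p i, j)))"
    by (rule det_transpose) auto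
  also have "\<dots> = signof p * det ?N" by (rule det_permute_rows[OF N p])
  also have "det ?N = det (mat n n (\<lambda>(i, j). M $$ (p i, j)))"
    by (rule det_transpose) auto
  also have "\<dots> = signof p * det M" by (rule det_permute_rows[OF M p])
  finally show ?thesis by (simp only: s)
qed

lemma char_poly_adj_matrix_unique:
  assumes xs: "distinct xs" and ys: "distinct ys" and st: "set xs = set ys"
  shows "char_poly (adj_matrix G xs) = char_poly (adj_matrix G ys)"
proof -
  have "mset ys = mset xs" using xs ys st set_eq_iff_mset_eq_distinct by metis
  then obtain p where p: "p permutes {..<length xs}" and py: "permute_list p xs = ys"
    by (rule mset_eq_permutation)
  define n where "n = length xs"
  have p': "p permutes {0..<n}" using p by (simp add: n_def lessThan_atLeast0)
  have len: "length ys = n" using py by (auto simp: n_def)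
  have lt: "p i < n" if "i < n" for i using permutes_in_image[OF p', of i] that by auto
  have nth: "ys ! i = xs ! p i" if "i < n" for i
    using that permute_list_nth[OF p, of i] py by (simp add: n_def)
  have inj: "p i = p j \<longleftrightarrow> i = j" for i j using permutes_inj[OF p'] by (auto dest: injD)
  have "char_poly_matrix (adj_matrix G ys) =
          mat n n (\<lambda>(i, j). char_poly_matrix (adj_matrix G xs) $$ (p i, p j))"
    using lt by (intro eq_matI)
      (auto simp: char_poly_matrix_def adj_matrix_def len nth inj simp flip: n_def)
  then show ?thesis
    unfolding char_poly_def
    using det_permute_both[OF _ p', of "char_poly_matrix (adj_matrix G xs)"]
    by (simp add: adj_matrix_def n_def)
qed

lemma graph_char_poly_eq:
  assumes "distinct xs" "set xs = verts G"
  shows "graph_char_poly G = char_poly (adj_matrix G xs)"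
  unfolding graph_char_poly_def
proof (rule char_poly_adj_matrix_unique)
  have "finite (verts G)" using assms by (metis List.finite_set)
  from vertex_list[OF this] assms
  show "distinct (vertex_list G)" "set (vertex_list G) = set xs" by auto
qed (rule assms)

text \<open>Existence and uniqueness of the orthogonal projection onto an eigenspace.\<close>

lemma scalar_prod_self_eq_0:
  fixes z :: "real vec"
  assumes "z \<in> carrier_vec n" "z \<bullet> z = 0"
  shows "z = 0\<^sub>v n"
proof -
  have "(\<Sum>i = 0..<n. z $ i * z $ i) = 0" using assms by (simp add: scalar_prod_def)
  then have "\<forall>i \<in> {0..<n}. z $ i * z $ i = 0"
    by (subst (asm) sum_nonneg_eq_0_iff) auto
  with assms(1) show ?thesis by (intro eq_vecI) auto
qed

lemma is_orth_proj_unique: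
  assumes P: "is_orth_proj n W P" and Q: "is_orth_proj n W Q" and W: "W \<subseteq> carrier_vec n"
  shows "P = Q"
proof -
  have c: "P \<in> carrier_mat n n" "Q \<in> carrier_mat n n" using P Q by (auto simp: is_orth_proj_def)
  have eq: "P *\<^sub>v x = Q *\<^sub>v x" if x: "x \<in> carrier_vec n" for x
  proof -
    define a b where "a = P *\<^sub>v x" and "b = Q *\<^sub>v x"
    have ab: "a \<in> W" "b \<in> W" "a \<in> carrier_vec n" "b \<in> carrier_vec n"
      using P Q x W unfolding is_orth_proj_def a_def b_def by auto
    have z: "(x - a) \<bullet> a = 0" "(x - a) \<bullet> b = 0" "(x - b) \<bullet> a = 0" "(x - b) \<bullet> b = 0"
      using P Q x ab unfolding is_orth_proj_def a_def b_def by auto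
    have "(a - b) \<bullet> (a - b) = (x - b) \<bullet> a - (x - b) \<bullet> b - ((x - a) \<bullet> a - (x - a) \<bullet> b)"
      using x ab by (simp add: minus_scalar_prod_distrib scalar_prod_minus_distrib)
    then have "a - b = 0\<^sub>v n" using z ab by (intro scalar_prod_self_eq_0) auto
    then have "a $ i = b $ i" if "i < n" for i
    proof -
      have "(a - b) $ i = 0" using \<open>a - b = 0\<^sub>v n\<close> that by simp
      then show ?thesis using ab that by simp
    qed
    then show "P *\<^sub>v x = Q *\<^sub>v x" using ab by (fold a_def b_def, intro eq_vecI) auto
  qed
  show ?thesis
  proof (rule eq_matI)
    fix i j assume "i < dim_row Q" "j < dim_col Q"
    then have "i < n" "j < n" using c by auto
    then show "P $$ (i, j) = Q $$ (i, j)"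
      using arg_cong[OF eq[of "unit_vec n j"], of "\<lambda>v. v $ i"] c
      by simp
  qed (use c in auto)
qed

lemma orthogonal_family_le:
  fixes u :: "nat \<Rightarrow> real vec"
  assumes c: "\<And>i. i \<le> n \<Longrightarrow> u i \<in> carrier_vec n" and nz: "\<And>i. i \<le> n \<Longrightarrow> u i \<noteq> 0\<^sub>v n"
    and o: "\<And>i j. i \<le> n \<Longrightarrow> j \<le> n \<Longrightarrow> i \<noteq> j \<Longrightarrow> u i \<bullet> u j = 0"
  shows False
proof -
  define M where "M = mat n n (\<lambda>(i, j). u i $ j)"
  have M: "M \<in> carrier_mat n n" by (simp add: M_def)
  have row: "row M i = u i" if "i < n" for i
    using that c[of i] by (intro eq_vecI) (auto simp: M_def)
  have "M *\<^sub>v u n = 0\<^sub>v n" using M o by (intro eq_vecI) (auto simp: row)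
  then have d: "det M = 0" using det_0_iff_vec_prod_zero[OF M] c nz by blast
  have "det (M * transpose_mat M) = (\<Prod>i \<leftarrow> diag_mat (M * transpose_mat M). i)"
    using M o by (subst det_upper_triangular[of _ n]) (auto simp: row)
  moreover have "0 \<notin> set (diag_mat (M * transpose_mat M))"
    using M nz c scalar_prod_self_eq_0[OF c]
    by (auto simp: diag_mat_def row) (metis less_imp_le)
  ultimately have "det (M * transpose_mat M) \<noteq> 0"
    by (simp add: prod_list_zero_iff)
  then show False using d det_mult[OF M, of "transpose_mat M"] M by simp
qed

lemma is_orth_proj_exists:
  fixes W :: "real vec set"
  assumes W: "W \<subseteq> carrier_vec n" and W0: "0\<^sub>v n \<in> W"
    and Wadd: "\<And>x y. x \<in> W \<Longrightarrow> y \<in> W \<Longrightarrow> x + y \<in> W"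
    and Wsm: "\<And>c x. x \<in> W \<Longrightarrow> c \<cdot>\<^sub>v x \<in> W"
  shows "\<exists>P. is_orth_proj n W P"
proof (rule ccontr)
  assume no: "\<nexists>P. is_orth_proj n W P"
  define fam where "fam k P u \<longleftrightarrow> P \<in> carrier_mat n n \<and> (\<forall>x \<in> carrier_vec n. P *\<^sub>v x \<in> W) \<and>
      (\<forall>x \<in> carrier_vec n. \<forall>y \<in> carrier_vec n. (x - P *\<^sub>v x) \<bullet> (P *\<^sub>v y) = 0) \<and>
      (\<forall>i < k. u i \<in> carrier_vec n \<and> u i \<noteq> 0\<^sub>v n \<and> P *\<^sub>v u i = u i) \<and>
      (\<forall>i < k. \<forall>j < k. i \<noteq> j \<longrightarrow> u i \<bullet> u j = 0)"
    for k P and u :: "nat \<Rightarrow> real vec"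
  have "\<exists>P u. fam k P u" for k
  proof (induction k)
    case 0
    have z: "0\<^sub>m n n *\<^sub>v x = 0\<^sub>v n" if "x \<in> carrier_vec n" for x :: "real vec"
      using that by (intro eq_vecI) auto
    have "fam 0 (0\<^sub>m n n) (\<lambda>_. 0\<^sub>v n)" using W0 by (auto simp: fam_def z)
    then show ?case by blast
  next
    case (Suc k)
    then obtain P u where I: "fam k P u" by blast
    then have P: "P \<in> carrier_mat n n" and PW: "\<And>x. x \<in> carrier_vec n \<Longrightarrow> P *\<^sub>v x \<in> W"
      and Po: "\<And>x y. x \<in> carrier_vec n \<Longrightarrow> y \<in> carrier_vec n \<Longrightarrow> (x - P *\<^sub>v x) \<bullet> (P *\<^sub>v y) = 0"
      and u: "\<And>i. i < k \<Longrightarrow> u i \<in> carrier_vec n" "\<And>i. i < k \<Longrightarrow> u i \<noteq> 0\<^sub>v n"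
        "\<And>i. i < k \<Longrightarrow> P *\<^sub>v u i = u i"
      and uo: "\<And>i j. i < k \<Longrightarrow> j < k \<Longrightarrow> i \<noteq> j \<Longrightarrow> u i \<bullet> u j = 0"
      by (auto simp: fam_def)
    have Pc: "P *\<^sub>v x \<in> carrier_vec n" if "x \<in> carrier_vec n" for x using P that by auto
    obtain x0 w where x0: "x0 \<in> carrier_vec n" and w: "w \<in> W" and ne: "(x0 - P *\<^sub>v x0) \<bullet> w \<noteq> 0"
      using no P PW unfolding is_orth_proj_def by blast
    have wc: "w \<in> carrier_vec n" using w W by auto
    define z where "z = w - P *\<^sub>v w"
    have zc: "z \<in> carrier_vec n" using wc Pc by (auto simp: z_def)
    have "z = w + (-1) \<cdot>\<^sub>v (P *\<^sub>v w)" using wc P by (intro eq_vecI) (auto simp: z_def)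
    then have zW: "z \<in> W" using w PW[OF wc] Wadd Wsm by metis
    have zP: "z \<bullet> (P *\<^sub>v y) = 0" if "y \<in> carrier_vec n" for y
      using Po[OF wc that] by (simp add: z_def)
    have Pz': "(P *\<^sub>v y) \<bullet> z = 0" if "y \<in> carrier_vec n" for y
      using zP[OF that] comm_scalar_prod[OF zc Pc[OF that]] by simp
    have z0: "z \<noteq> 0\<^sub>v n"
    proof
      assume "z = 0\<^sub>v n"
      have "w = P *\<^sub>v w"
      proof (rule eq_vecI)
        fix i assume "i < dim_vec (P *\<^sub>v w)"
        then have "i < n" using P by auto
        moreover from this have "(w - P *\<^sub>v w) $ i = 0"
          using \<open>z = 0\<^sub>v n\<close> by (simp add: z_def)
        ultimately show "w $ i = (P *\<^sub>v w) $ i" using wc P by simp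
      qed (use wc P in auto)
      then show False using ne Po[OF x0 wc] by simp
    qed
    then have zz: "z \<bullet> z \<noteq> 0" using scalar_prod_self_eq_0[OF zc] by blast
    have "(z - P *\<^sub>v z) \<bullet> (P *\<^sub>v z) = 0" using Po[OF zc zc] .
    then have "(P *\<^sub>v z) \<bullet> (P *\<^sub>v z) = 0"
      using zP[OF zc] minus_scalar_prod_distrib[OF zc Pc[OF zc] Pc[OF zc]] by simp
    then have Pz: "P *\<^sub>v z = 0\<^sub>v n" by (rule scalar_prod_self_eq_0[OF Pc[OF zc]])
    define Q where "Q = P + mat n n (\<lambda>(i, j). z $ i * z $ j / (z \<bullet> z))"
    have Q: "Q \<in> carrier_mat n n" using P by (auto simp: Q_def)
    have Qx: "Q *\<^sub>v x = P *\<^sub>v x + (z \<bullet> x / (z \<bullet> z)) \<cdot>\<^sub>v z" if x: "x \<in> carrier_vec n" for x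
    proof -
      have "mat n n (\<lambda>(i, j). z $ i * z $ j / (z \<bullet> z)) *\<^sub>v x = (z \<bullet> x / (z \<bullet> z)) \<cdot>\<^sub>v z"
        (is "?Z *\<^sub>v x = _")
      proof (rule eq_vecI)
        fix i assume "i < dim_vec ((z \<bullet> x / (z \<bullet> z)) \<cdot>\<^sub>v z)"
        then have i: "i < n" using zc by auto
        have "(?Z *\<^sub>v x) $ i = (\<Sum>j = 0..<n. z $ i * z $ j / (z \<bullet> z) * x $ j)"
          using i x by (auto simp: scalar_prod_def)
        also have "\<dots> = (\<Sum>j = 0..<n. z $ j * x $ j) / (z \<bullet> z) * z $ i"
          unfolding sum_divide_distrib sum_distrib_right by (intro sum.cong) auto
        also have "(\<Sum>j = 0..<n. z $ j * x $ j) = z \<bullet> x" using x by (simp add: scalar_prod_def)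
        finally show "(?Z *\<^sub>v x) $ i = ((z \<bullet> x / (z \<bullet> z)) \<cdot>\<^sub>v z) $ i" using i zc by simp
      qed (use zc in auto)
      moreover have "Q *\<^sub>v x = P *\<^sub>v x + ?Z *\<^sub>v x"
        unfolding Q_def by (rule add_mult_distrib_mat_vec[OF P _ x]) auto
      ultimately show ?thesis by simp
    qed
    define u' where "u' = u(k := z)"
    have "fam (Suc k) Q u'"
      unfolding fam_def
    proof (intro conjI allI impI ballI)
      show "Q \<in> carrier_mat n n" by (rule Q)
    next
      fix x :: "real vec" assume x: "x \<in> carrier_vec n"
      show "Q *\<^sub>v x \<in> W" unfolding Qx[OF x] using PW[OF x] zW Wadd Wsm by blast
    next
      fix x y :: "real vec" assume x: "x \<in> carrier_vec n" and y: "y \<in> carrier_vec n"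
      define c d where "c = z \<bullet> x / (z \<bullet> z)" and "d = z \<bullet> y / (z \<bullet> z)"
      have "(x - (P *\<^sub>v x + c \<cdot>\<^sub>v z)) \<bullet> (P *\<^sub>v y + d \<cdot>\<^sub>v z) =
          (x - P *\<^sub>v x) \<bullet> (P *\<^sub>v y) - c * (z \<bullet> (P *\<^sub>v y)) +
          d * (z \<bullet> x) - d * ((P *\<^sub>v x) \<bullet> z) - c * d * (z \<bullet> z)"
        using x y Pc[OF x] Pc[OF y] zc comm_scalar_prod[OF x zc]
        by (simp add: minus_scalar_prod_distrib[of _ n] scalar_prod_add_distrib[of _ n]
            add_scalar_prod_distrib[of _ n] algebra_simps)
      also have "\<dots> = 0"
        using Po[OF x y] zP[OF y] Pz'[OF x] zz by (simp add: c_def d_def)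
      finally show "(x - Q *\<^sub>v x) \<bullet> (Q *\<^sub>v y) = 0"
        unfolding Qx[OF x] Qx[OF y] c_def d_def .
    next
      fix i assume i: "i < Suc k"
      show "u' i \<in> carrier_vec n" "u' i \<noteq> 0\<^sub>v n"
        using i u zc z0 by (auto simp: u'_def less_Suc_eq)
      show "Q *\<^sub>v u' i = u' i"
      proof (cases "i = k")
        case True
        then show ?thesis using Qx[OF zc] Pz zz zc by (simp add: u'_def)
      next
        case False
        then have k: "i < k" using i by simp
        have "z \<bullet> u i = 0" using zP[OF u(1)[OF k]] u(3)[OF k] by simp
        then show ?thesis using Qx[OF u(1)[OF k]] u(1,3)[OF k] zc False
          by (simp add: u'_def) (intro eq_vecI, auto)
      qed
    next
      fix i j assume ij: "i < Suc k" "j < Suc k" "i \<noteq> j"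
      have zu: "z \<bullet> u i = 0" "u i \<bullet> z = 0" if "i < k" for i
        using zP[OF u(1)[OF that]] Pz'[OF u(1)[OF that]] u(3)[OF that] by auto
      show "u' i \<bullet> u' j = 0"
        using ij uo zu by (auto simp: u'_def less_Suc_eq)
    qed
    then show ?case by blast
  qed
  from this[of "Suc n"] obtain P u where "fam (Suc n) P u" by blast
  then show False by (intro orthogonal_family_le[of n u]) (auto simp: fam_def less_Suc_eq_le)
qed

lemma eigenprojection:
  assumes A: "A \<in> carrier_mat n n"
  shows "is_orth_proj n (eigenspace A \<theta>) (eigenprojection A \<theta>)"
proof -
  have E: "eigenspace A \<theta> = {x \<in> carrier_vec n. A *\<^sub>v x = \<theta> \<cdot>\<^sub>v x}"
    using A by (simp add: eigenspace_def)
  have "\<exists>P. is_orth_proj n (eigenspace A \<theta>) P"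
  proof (rule is_orth_proj_exists)
    show "0\<^sub>v n \<in> eigenspace A \<theta>" using A by (auto simp: E)
    show "x + y \<in> eigenspace A \<theta>" if "x \<in> eigenspace A \<theta>" "y \<in> eigenspace A \<theta>" for x y
      using that by (auto simp: E mult_add_distrib_mat_vec[OF A] smult_add_distrib_vec)
    show "c \<cdot>\<^sub>v x \<in> eigenspace A \<theta>" if "x \<in> eigenspace A \<theta>" for c x
      using that by (auto simp: E mult_mat_vec[OF A] smult_smult_assoc mult.commute)
  qed (auto simp: E)
  moreover have "eigenspace A \<theta> \<subseteq> carrier_vec n" by (auto simp: E)
  ultimately have "\<exists>!P. is_orth_proj n (eigenspace A \<theta>) P"
    using is_orth_proj_unique by blast
  then have "is_orth_proj n (eigenspace A \<theta>) (THE P. is_orth_proj n (eigenspace A \<theta>) P)"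
    by (rule theI')
  then show ?thesis using A by (simp add: eigenprojection_def)
qed

end

theory Submission
  imports Defs
begin

text \<open>
  Let \<open>B\<close> be the adjacency matrix \<open>A\<close> with the row and column of \<open>v\<close> zeroed. The diagonal entries
  of \<open>(t - B)\<^sup>-\<^sup>1\<close> at \<open>i\<close>, \<open>j\<close>, \<open>k\<close> are sums \<open>\<Sum> w / (t - \<sigma>)\<close> with positive weights. Strong
  cospectrality forces their poles to be pairwise disjoint, and at a pole of one of them the other two
  take the same value, namely the common diagonal entry of \<open>(t - A)\<^sup>-\<^sup>1\<close>. So the product of the three
  functions has only non-negative residues. As it is \<open>O(1/t\<^sup>3)\<close>, the residues add up to zero, hence each
  function vanishes at the poles of the other two. But at the largest of all poles the other two
  functions are positive.
\<close>

section \<open>Spectral decomposition of real symmetric matrices\<close>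

lemma symmetric_mat_scalar_prod:
  fixes A :: "'a :: comm_ring_1 mat"
  assumes "A \<in> carrier_mat n n" "transpose_mat A = A" "x \<in> carrier_vec n" "y \<in> carrier_vec n"
  shows "(A *\<^sub>v x) \<bullet> y = x \<bullet> (A *\<^sub>v y)"
  using transpose_vec_mult_scalar[of A n n y x] assms by simp

lemma symmetric_matI:
  fixes A :: "'a :: comm_ring_1 mat"
  assumes A: "A \<in> carrier_mat n n"
    and sym: "\<And>x y. x \<in> carrier_vec n \<Longrightarrow> y \<in> carrier_vec n \<Longrightarrow>
      (A *\<^sub>v x) \<bullet> y = x \<bullet> (A *\<^sub>v y)"
  shows "transpose_mat A = A"
proof (rule eq_matI)
  fix i j assume "i < dim_row A" "j < dim_col A"
  then have ij: "i < n" "j < n" using A by auto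
  then have "A $$ (j, i) = (A *\<^sub>v unit_vec n i) \<bullet> unit_vec n j" using A by simp
  also have "\<dots> = unit_vec n i \<bullet> (A *\<^sub>v unit_vec n j)" by (rule sym) auto
  also have "\<dots> = A $$ (i, j)" using ij A by simp
  finally show "transpose_mat A $$ (i, j) = A $$ (i, j)" using ij A by simp
qed (use A in auto)

lemma smult_mat_mult_vec:
  fixes A :: "'a :: comm_semiring_0 mat"
  assumes "A \<in> carrier_mat nr nc" "x \<in> carrier_vec nc"
  shows "(k \<cdot>\<^sub>m A) *\<^sub>v x = k \<cdot>\<^sub>v (A *\<^sub>v x)"
  using assms
  by (intro eq_vecI) (auto simp: scalar_prod_def sum_distrib_left mult.assoc intro!: sum.cong)

text \<open>Writing a complex eigenvector as \<open>w = x + i y\<close> splits the eigenvalue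
  equation into two real ones. Comparing \<open>(S x) \<bullet> y\<close> with
  \<open>x \<bullet> (S y)\<close> then gives
  \<open>Im k * (x \<bullet> x + y \<bullet> y) = 0\<close>. Once \<open>Im k = 0\<close>, whichever
  of \<open>x\<close> and \<open>y\<close> is nonzero is a real eigenvector.\<close>

lemma symmetric_complex_eigenvalue_real:
  fixes S :: "real mat"
  assumes S: "S \<in> carrier_mat n n" and sym: "transpose_mat S = S"
    and ev: "eigenvalue (map_mat complex_of_real S) k"
  shows "Im k = 0" "eigenvalue S (Re k)"
proof -
  obtain w where w: "w \<in> carrier_vec n" "w \<noteq> 0\<^sub>v n"
    "map_mat complex_of_real S *\<^sub>v w = k \<cdot>\<^sub>v w"
    using ev S by (auto simp: eigenvalue_def eigenvector_def)
  define x y where "x = map_vec Re w" and "y = map_vec Im w"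
  have c: "x \<in> carrier_vec n" "y \<in> carrier_vec n" using w by (auto simp: x_def y_def)
  have row: "(\<Sum>j<n. complex_of_real (S $$ (i, j)) * w $ j) = k * w $ i" if "i < n" for i
  proof -
    have "(map_mat complex_of_real S *\<^sub>v w) $ i = k * w $ i" using w that by simp
    then show ?thesis using that S w(1)
      by (simp add: scalar_prod_def lessThan_atLeast0)
  qed
  have Sx: "S *\<^sub>v x = Re k \<cdot>\<^sub>v x - Im k \<cdot>\<^sub>v y"
  proof (rule eq_vecI)
    fix i assume "i < dim_vec (Re k \<cdot>\<^sub>v x - Im k \<cdot>\<^sub>v y)"
    then have i: "i < n" using c by simp
    show "(S *\<^sub>v x) $ i = (Re k \<cdot>\<^sub>v x - Im k \<cdot>\<^sub>v y) $ i"
      using arg_cong[OF row[OF i], of Re] i S w(1)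
      by (simp add: scalar_prod_def x_def y_def lessThan_atLeast0)
  qed (use S c in auto)
  have Sy: "S *\<^sub>v y = Im k \<cdot>\<^sub>v x + Re k \<cdot>\<^sub>v y"
  proof (rule eq_vecI)
    fix i assume "i < dim_vec (Im k \<cdot>\<^sub>v x + Re k \<cdot>\<^sub>v y)"
    then have i: "i < n" using c by simp
    show "(S *\<^sub>v y) $ i = (Im k \<cdot>\<^sub>v x + Re k \<cdot>\<^sub>v y) $ i"
      using arg_cong[OF row[OF i], of Im] i S w(1)
      by (simp add: scalar_prod_def x_def y_def lessThan_atLeast0)
  qed (use S c in auto)
  have xy: "x \<noteq> 0\<^sub>v n \<or> y \<noteq> 0\<^sub>v n"
  proof (rule ccontr)
    assume n: "\<not> ?thesis"
    have "w = 0\<^sub>v n"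
    proof (rule eq_vecI)
      fix i assume "i < dim_vec (0\<^sub>v n :: complex vec)"
      then have i: "i < n" by simp
      have "x $ i = 0" "y $ i = 0" using n i by auto
      then show "w $ i = 0\<^sub>v n $ i" using i w by (auto simp: x_def y_def complex_eq_iff)
    qed (use w in auto)
    then show False using w by simp
  qed
  have "Im k * (x \<bullet> x + y \<bullet> y) = 0"
    using symmetric_mat_scalar_prod[OF S sym c] comm_scalar_prod[OF c] c
    by (simp add: Sx Sy minus_scalar_prod_distrib[of _ n] scalar_prod_add_distrib[of _ n]
        algebra_simps)
  moreover have "x \<bullet> x + y \<bullet> y \<noteq> 0"
  proof
    assume "x \<bullet> x + y \<bullet> y = 0"
    moreover have "x \<bullet> x \<ge> 0" "y \<bullet> y \<ge> 0" by (auto simp: scalar_prod_def sum_nonneg)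
    ultimately have "x \<bullet> x = 0" "y \<bullet> y = 0" by linarith+
    then show False using xy scalar_prod_self_eq_0 c by blast
  qed
  ultimately show I: "Im k = 0" by simp
  then have "S *\<^sub>v x = Re k \<cdot>\<^sub>v x" "S *\<^sub>v y = Re k \<cdot>\<^sub>v y"
    using Sx Sy c by (auto intro!: eq_vecI)
  then show "eigenvalue S (Re k)" using xy c S by (auto simp: eigenvalue_def eigenvector_def)
qed

text \<open>Over the complex numbers the characteristic polynomial splits. Its roots are real
  eigenvalues of \<open>S\<close>, hence all equal to 1, and the determinant is their
  product.\<close>

lemma symmetric_det_eq_1:
  fixes S :: "real mat"
  assumes S: "S \<in> carrier_mat n n" and sym: "transpose_mat S = S"
    and ev: "\<And>\<theta>. eigenvalue S \<theta> \<Longrightarrow> \<theta> = 1"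
  shows "det S = 1"
proof -
  define C where "C = map_mat complex_of_real S"
  have C: "C \<in> carrier_mat n n" using S by (simp add: C_def)
  obtain as where as: "char_poly C = (\<Prod>a\<leftarrow>as. [:- a, 1:])" "length as = n"
    using char_poly_factorized[OF C] by blast
  have "a = 1" if "a \<in> set as" for a
  proof -
    have "poly (char_poly C) a = 0"
      using that by (auto simp: as(1) poly_prod_list prod_list_zero_iff)
    then have "eigenvalue C a" using eigenvalue_root_char_poly[OF C] by simp
    then have "Im a = 0" "Re a = 1"
      using symmetric_complex_eigenvalue_real[OF S sym] ev by (auto simp: C_def)
    then show "a = 1" by (simp add: complex_eq_iff)
  qed
  then have "as = replicate n 1" using as(2) by (metis replicate_eqI)
  then have "poly (char_poly C) 0 = (- 1) ^ n" by (simp add: as(1) poly_prod_list)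
  moreover have "poly (char_poly C) 0 = (- 1) ^ n * det C"
  proof -
    have "- char_matrix C 0 = (- 1) \<cdot>\<^sub>m C"
      using C by (intro eq_matI) (auto simp: char_matrix_def)
    then show ?thesis using C by (simp add: char_poly_matrix[OF C])
  qed
  ultimately have "det C = 1" by simp
  then show ?thesis by (simp add: C_def)
qed

lemma eigenspaceD:
  assumes "x \<in> eigenspace A \<theta>" "A \<in> carrier_mat n n"
  shows "x \<in> carrier_vec n" "A *\<^sub>v x = \<theta> \<cdot>\<^sub>v x"
  using assms by (auto simp: eigenspace_def)

text \<open>Let \<open>U\<close> be the space of vectors orthogonal to all eigenspaces, and let \<open>M \<kappa>\<close> act as \<open>\<kappa> A\<close> on \<open>U\<close>
  and as the identity on its complement. As \<open>U\<close> contains no eigenvector, \<open>1\<close> is the only eigenvalue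
  of \<open>M \<kappa>\<close> for \<open>\<kappa> \<noteq> 0\<close>, so \<open>det (M \<kappa>) = 1\<close>; but \<open>M 0\<close> annihilates \<open>U\<close>.\<close>

lemma symmetric_orthogonal_to_eigenspaces:
  assumes A: "A \<in> carrier_mat n n" and sym: "transpose_mat A = A"
    and r: "r \<in> carrier_vec n"
    and orth: "\<And>\<theta> w. w \<in> eigenspace A \<theta> \<Longrightarrow> r \<bullet> w = 0"
  shows "r = 0\<^sub>v n"
proof (rule ccontr)
  assume r0: "r \<noteq> 0\<^sub>v n"
  note Asym = symmetric_mat_scalar_prod[OF A sym]
  have Ac: "A *\<^sub>v x \<in> carrier_vec n" for x using A by (intro carrier_vecI) simp
  define U where "U = {x \<in> carrier_vec n. \<forall>\<theta>. \<forall>w \<in> eigenspace A \<theta>. x \<bullet> w = 0}"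
  have Uc: "U \<subseteq> carrier_vec n" by (auto simp: U_def)
  have ec: "w \<in> carrier_vec n" if "w \<in> eigenspace A \<theta>" for w \<theta>
    using that A by (auto simp: eigenspace_def)
  have U_smult: "c \<cdot>\<^sub>v x \<in> U" if "x \<in> U" for c x using that ec by (auto simp: U_def)
  have U_add: "x + y \<in> U" if "x \<in> U" "y \<in> U" for x y
    using that ec by (auto simp: U_def add_scalar_prod_distrib[of _ n])
  have U_A: "A *\<^sub>v x \<in> U" if "x \<in> U" for x
  proof -
    have "(A *\<^sub>v x) \<bullet> w = 0" if w: "w \<in> eigenspace A \<theta>" for w \<theta>
      using Asym[of x w] \<open>x \<in> U\<close> ec[OF w] eigenspaceD[OF w A] w by (auto simp: U_def)
    then show ?thesis using Ac by (simp add: U_def)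
  qed
  have "0\<^sub>v n \<in> U" using ec by (auto simp: U_def)
  then obtain P where "is_orth_proj n U P"
    using is_orth_proj_exists[OF Uc] U_add U_smult by blast
  then have P: "P \<in> carrier_mat n n" and PU: "\<And>x. x \<in> carrier_vec n \<Longrightarrow> P *\<^sub>v x \<in> U"
    and Po: "\<And>x w. x \<in> carrier_vec n \<Longrightarrow> w \<in> U \<Longrightarrow> (x - P *\<^sub>v x) \<bullet> w = 0"
    by (auto simp: is_orth_proj_def)
  have Pc: "P *\<^sub>v x \<in> carrier_vec n" for x using P by (intro carrier_vecI) simp
  have Pw: "x \<bullet> w = (P *\<^sub>v x) \<bullet> w" if "x \<in> carrier_vec n" "w \<in> U" for x w
    using Po[OF that] that Uc by (simp add: minus_scalar_prod_distrib[of _ n] Pc subset_iff)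
  have Pw': "w \<bullet> x = w \<bullet> (P *\<^sub>v x)" if "x \<in> carrier_vec n" "w \<in> U" for x w
    using Pw[OF that] that Uc comm_scalar_prod[of x n w] comm_scalar_prod[of "P *\<^sub>v x" n w] Pc
    by (simp add: subset_iff)
  define M where "M = (\<lambda>\<kappa>. \<kappa> \<cdot>\<^sub>m (A * P) + (1\<^sub>m n - P))"
  have M: "M \<kappa> \<in> carrier_mat n n" for \<kappa> using A P by (auto simp: M_def)
  have Mx: "M \<kappa> *\<^sub>v x = \<kappa> \<cdot>\<^sub>v (A *\<^sub>v (P *\<^sub>v x)) + (x - P *\<^sub>v x)"
    if "x \<in> carrier_vec n" for \<kappa> x
  proof -
    have AP: "A * P \<in> carrier_mat n n" using A P by simp
    have "M \<kappa> *\<^sub>v x = (\<kappa> \<cdot>\<^sub>m (A * P)) *\<^sub>v x + (1\<^sub>m n - P) *\<^sub>v x"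
      unfolding M_def using A P that by (intro add_mult_distrib_mat_vec) auto
    also have "(\<kappa> \<cdot>\<^sub>m (A * P)) *\<^sub>v x = \<kappa> \<cdot>\<^sub>v (A *\<^sub>v (P *\<^sub>v x))"
      using smult_mat_mult_vec[OF AP that] A P that by simp
    also have "(1\<^sub>m n - P) *\<^sub>v x = x - P *\<^sub>v x"
      using minus_mult_distrib_mat_vec[of "1\<^sub>m n" n n P x] P that by simp
    finally show ?thesis .
  qed
  have Msym: "transpose_mat (M \<kappa>) = M \<kappa>" for \<kappa>
  proof (rule symmetric_matI[OF M])
    fix x y :: "real vec" assume x: "x \<in> carrier_vec n" and y: "y \<in> carrier_vec n"
    have "(A *\<^sub>v (P *\<^sub>v x)) \<bullet> y = (A *\<^sub>v (P *\<^sub>v x)) \<bullet> (P *\<^sub>v y)"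
      using Pw'[OF y] U_A PU[OF x] by blast
    also have "\<dots> = (P *\<^sub>v x) \<bullet> (A *\<^sub>v (P *\<^sub>v y))" using Asym Pc by simp
    also have "\<dots> = x \<bullet> (A *\<^sub>v (P *\<^sub>v y))" using Pw[OF x] U_A PU[OF y] by simp
    finally have "(A *\<^sub>v (P *\<^sub>v x)) \<bullet> y = x \<bullet> (A *\<^sub>v (P *\<^sub>v y))" .
    moreover have "(P *\<^sub>v x) \<bullet> y = x \<bullet> (P *\<^sub>v y)"
      using Pw[OF x PU[OF y]] Pw'[OF y PU[OF x]] by simp
    ultimately show "(M \<kappa> *\<^sub>v x) \<bullet> y = x \<bullet> (M \<kappa> *\<^sub>v y)"
      using x y Ac Pc
      by (simp add: Mx add_scalar_prod_distrib[of _ n] scalar_prod_add_distrib[of _ n]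
          minus_scalar_prod_distrib[of _ n] scalar_prod_minus_distrib[of _ n]
          smult_scalar_prod_distrib[of _ n])
  qed
  have "det (M \<kappa>) = 1" if k: "\<kappa> \<noteq> 0" for \<kappa>
  proof (rule symmetric_det_eq_1[OF M Msym])
    fix \<mu> assume "eigenvalue (M \<kappa>) \<mu>"
    then obtain w where w: "w \<in> carrier_vec n" "w \<noteq> 0\<^sub>v n" "M \<kappa> *\<^sub>v w = \<mu> \<cdot>\<^sub>v w"
      using M[of \<kappa>] by (auto simp: eigenvalue_def eigenvector_def)
    define p q where "p = P *\<^sub>v w" and "q = w - p"
    have pU: "p \<in> U" and pc: "p \<in> carrier_vec n" and qc: "q \<in> carrier_vec n"
      using PU[OF w(1)] Pc w by (auto simp: p_def q_def)
    have qU: "q \<bullet> u = 0" if "u \<in> U" for u using Po[OF w(1) that] by (simp add: p_def q_def)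
    \<comment> \<open>With \<open>w = p + q\<close>, the equation for \<open>w\<close> reads
      \<open>\<kappa> A p + q = \<mu> (p + q)\<close>, that is \<open>z = (\<mu> - 1) q\<close>. As
      \<open>z\<close> lies in \<open>U\<close> and \<open>q\<close> is orthogonal to
      \<open>U\<close>, both sides vanish.\<close>
    define z where "z = \<kappa> \<cdot>\<^sub>v (A *\<^sub>v p) + (- \<mu>) \<cdot>\<^sub>v p"
    have zU: "z \<in> U" unfolding z_def using pU U_A U_add U_smult by blast
    have zc: "z \<in> carrier_vec n" using zU Uc by auto
    have zq: "z = (\<mu> - 1) \<cdot>\<^sub>v q"
    proof (rule eq_vecI)
      fix i assume "i < dim_vec ((\<mu> - 1) \<cdot>\<^sub>v q)"
      then have i: "i < n" using qc by simp
      have "(M \<kappa> *\<^sub>v w) $ i = (\<mu> \<cdot>\<^sub>v w) $ i" by (simp only: w(3))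
      then show "z $ i = ((\<mu> - 1) \<cdot>\<^sub>v q) $ i"
        using i w(1) pc Ac[of p] by (simp add: Mx z_def q_def algebra_simps flip: p_def)
    qed (use zc qc in auto)
    have "z \<bullet> z = (\<mu> - 1) * (q \<bullet> z)" using zc qc by (subst (1) zq) simp
    then have z0: "z = 0\<^sub>v n" using qU[OF zU] scalar_prod_self_eq_0[OF zc] by simp
    show "\<mu> = 1"
    proof (rule ccontr)
      \<comment> \<open>Now \<open>q = 0\<close>, so \<open>w = p\<close> would be an eigenvector of
        \<open>A\<close> inside \<open>U\<close>, hence orthogonal to itself.\<close>
      assume l: "\<mu> \<noteq> 1"
      have wp: "w = p"
      proof (rule eq_vecI)
        fix i assume "i < dim_vec p"
        then have i: "i < n" using pc by simp
        have "z $ i = 0" using z0 i by simp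
        then have "q $ i = 0" using zq i qc l by simp
        then show "w $ i = p $ i" using i pc w by (simp add: q_def)
      qed (use pc w in auto)
      have "A *\<^sub>v p = (\<mu> / \<kappa>) \<cdot>\<^sub>v p"
      proof (rule eq_vecI)
        fix i assume "i < dim_vec ((\<mu> / \<kappa>) \<cdot>\<^sub>v p)"
        then have i: "i < n" using pc by simp
        have "z $ i = 0" using z0 i by simp
        then show "(A *\<^sub>v p) $ i = ((\<mu> / \<kappa>) \<cdot>\<^sub>v p) $ i"
          using i pc A k by (simp add: z_def field_simps)
      qed (use pc A in auto)
      then have "p \<in> eigenspace A (\<mu> / \<kappa>)" using pc A by (simp add: eigenspace_def)
      then have "p \<bullet> p = 0" using pU by (auto simp: U_def)
      then show False using scalar_prod_self_eq_0[OF pc] w(2) wp by simp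
    qed
  qed
  \<comment> \<open>The Leibniz formula shows that the determinant is polynomial in
    \<open>\<kappa>\<close>, so the value 1 extends by continuity to
    \<open>\<kappa> = 0\<close>.\<close>
  then have "\<forall>\<^sub>F \<kappa> in at 0. det (M \<kappa>) = 1" by (simp add: eventually_at_filter)
  then have "((\<lambda>\<kappa>. det (M \<kappa>)) \<longlongrightarrow> 1) (at 0)" by (rule tendsto_eventually)
  moreover have "((\<lambda>\<kappa>. det (M \<kappa>)) \<longlongrightarrow> det (M 0)) (at 0)"
  proof -
    have "det (M \<kappa>) = (\<Sum>p | p permutes {0..<n}. signof p *
        (\<Prod>i = 0..<n. \<kappa> * (A * P) $$ (i, p i) + (1\<^sub>m n - P) $$ (i, p i)))" for \<kappa>
      unfolding det_def'[OF M]
    proof (intro sum.cong prod.cong arg_cong2[where f = "(*)"] refl)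
      fix p i assume "p \<in> {p. p permutes {0..<n}}" "i \<in> {0..<n}"
      then have "i < n" "p i < n" using permutes_in_image[of p "{0..<n}" i] by auto
      then show "M \<kappa> $$ (i, p i) = \<kappa> * (A * P) $$ (i, p i) + (1\<^sub>m n - P) $$ (i, p i)"
        using A P by (simp add: M_def)
    qed
    then show ?thesis by (simp only:) (intro tendsto_intros)
  qed
  ultimately have "det (M 0) = 1" using tendsto_unique[OF at_neq_bot] by blast
  moreover have "M 0 *\<^sub>v r = 0\<^sub>v n"
  proof -
    \<comment> \<open>The vector \<open>r - P r\<close> lies in \<open>U\<close> and is orthogonal
      to \<open>U\<close>. So \<open>P\<close> fixes \<open>r\<close>, and \<open>M 0\<close> maps
      \<open>r\<close> to \<open>r - P r = 0\<close>.\<close>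
    have rU: "r \<in> U" using r orth by (simp add: U_def)
    have "r - P *\<^sub>v r = r + (- 1) \<cdot>\<^sub>v (P *\<^sub>v r)" using r Pc by (intro eq_vecI) auto
    then have "r - P *\<^sub>v r \<in> U" using rU PU[OF r] U_add U_smult by metis
    then have "r - P *\<^sub>v r = 0\<^sub>v n"
      using Po[OF r] scalar_prod_self_eq_0[of "r - P *\<^sub>v r" n] r Pc by simp
    then show ?thesis using r A by (simp add: Mx) (auto intro!: eq_vecI)
  qed
  ultimately show False using det_0_iff_vec_prod_zero[OF M] r r0 by (metis zero_neq_one)
qed

lemma finite_eigenvalues:
  assumes A: "(A :: 'a :: field mat) \<in> carrier_mat n n"
  shows "finite {\<theta>. eigenvalue A \<theta>}"
proof -
  have "char_poly A \<noteq> 0" using degree_monic_char_poly[OF A] by auto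
  then show ?thesis using poly_roots_finite by (simp add: eigenvalue_root_char_poly[OF A])
qed

lemma eigenspace_orthogonal:
  assumes A: "A \<in> carrier_mat n n" and sym: "transpose_mat A = A"
    and x: "x \<in> eigenspace A \<theta>" and y: "y \<in> eigenspace A \<mu>" and ne: "\<theta> \<noteq> \<mu>"
  shows "x \<bullet> y = 0"
proof -
  note xy = eigenspaceD[OF x A] eigenspaceD[OF y A]
  have "\<theta> * (x \<bullet> y) = \<mu> * (x \<bullet> y)"
    using symmetric_mat_scalar_prod[OF A sym, of x y] xy by simp
  then show ?thesis using ne by simp
qed

lemma eigenprojection_props:
  assumes A: "A \<in> carrier_mat n n" and x: "x \<in> carrier_vec n"
  shows "eigenprojection A \<theta> *\<^sub>v x \<in> carrier_vec n"
    and "eigenprojection A \<theta> *\<^sub>v x \<in> eigenspace A \<theta>"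
    and "w \<in> eigenspace A \<theta> \<Longrightarrow> w \<bullet> (eigenprojection A \<theta> *\<^sub>v x) = w \<bullet> x"
proof -
  let ?p = "eigenprojection A \<theta> *\<^sub>v x"
  have p: "?p \<in> eigenspace A \<theta>" "\<And>w. w \<in> eigenspace A \<theta> \<Longrightarrow> (x - ?p) \<bullet> w = 0"
    using eigenprojection[OF A] x by (auto simp: is_orth_proj_def)
  note c = eigenspaceD(1)[OF p(1) A]
  show "?p \<in> eigenspace A \<theta>" "?p \<in> carrier_vec n" by (fact p(1) c)+
  assume w: "w \<in> eigenspace A \<theta>"
  note wc = eigenspaceD(1)[OF w A]
  show "w \<bullet> ?p = w \<bullet> x"
    using p(2)[OF w] x c wc comm_scalar_prod[OF x wc] comm_scalar_prod[OF c wc]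
    by (simp add: minus_scalar_prod_distrib[of _ n])
qed

text \<open>The dimension is an argument so that the empty sum is the zero vector of a definite
  length.\<close>

definition vec_sum :: "nat \<Rightarrow> ('b \<Rightarrow> 'a :: comm_monoid_add vec) \<Rightarrow> 'b set \<Rightarrow> 'a vec" where
  "vec_sum n f S = vec n (\<lambda>m. \<Sum>s\<in>S. f s $ m)"

lemma vec_sum_carrier [simp]: "vec_sum n f S \<in> carrier_vec n"
  by (simp add: vec_sum_def)

lemma index_vec_sum [simp]: "m < n \<Longrightarrow> vec_sum n f S $ m = (\<Sum>s\<in>S. f s $ m)"
  by (simp add: vec_sum_def)

lemma scalar_prod_vec_sum:
  fixes w :: "'a :: comm_semiring_0 vec"
  assumes "\<And>s. s \<in> S \<Longrightarrow> f s \<in> carrier_vec n"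
  shows "w \<bullet> vec_sum n f S = (\<Sum>s\<in>S. w \<bullet> f s)"
proof -
  have "w \<bullet> vec_sum n f S = (\<Sum>m = 0..<n. \<Sum>s\<in>S. w $ m * f s $ m)"
    by (simp add: scalar_prod_def vec_sum_def sum_distrib_left)
  also have "\<dots> = (\<Sum>s\<in>S. \<Sum>m = 0..<n. w $ m * f s $ m)" by (rule sum.swap)
  also have "\<dots> = (\<Sum>s\<in>S. w \<bullet> f s)"
    using assms[THEN carrier_vecD] by (intro sum.cong refl) (simp add: scalar_prod_def)
  finally show ?thesis .
qed

lemma mult_mat_vec_sum:
  fixes A :: "'a :: comm_semiring_0 mat"
  assumes A: "A \<in> carrier_mat n n" and f: "\<And>s. s \<in> S \<Longrightarrow> f s \<in> carrier_vec n"
  shows "A *\<^sub>v vec_sum n f S = vec_sum n (\<lambda>s. A *\<^sub>v f s) S"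
proof (rule eq_vecI)
  fix i assume "i < dim_vec (vec_sum n (\<lambda>s. A *\<^sub>v f s) S)"
  then have "i < n" by (simp add: vec_sum_def)
  then show "(A *\<^sub>v vec_sum n f S) $ i = vec_sum n (\<lambda>s. A *\<^sub>v f s) S $ i"
    using A by (simp add: scalar_prod_vec_sum[OF f])
qed (use A in \<open>auto simp: vec_sum_def\<close>)

text \<open>Eigenspaces are mutually orthogonal, so pairing the sum with a vector \<open>w\<close>
  of one eigenspace leaves a single term, equal to \<open>w \<bullet> x\<close>. The difference of
  \<open>x\<close> and the sum is therefore orthogonal to all eigenspaces, hence zero.\<close>

theorem spectral_decomposition:
  assumes A: "A \<in> carrier_mat n n" and sym: "transpose_mat A = A" and x: "x \<in> carrier_vec n"
  shows "vec_sum n (\<lambda>\<theta>. eigenprojection A \<theta> *\<^sub>v x) {\<theta>. eigenvalue A \<theta>} = x"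
proof -
  let ?E = "\<lambda>\<theta>. eigenprojection A \<theta> *\<^sub>v x" and ?S = "{\<theta>. eigenvalue A \<theta>}"
  note E = eigenprojection_props[OF A x]
  define s where "s = vec_sum n ?E ?S"
  have sc: "s \<in> carrier_vec n" by (simp add: s_def)
  have "x - s = 0\<^sub>v n"
  proof (rule symmetric_orthogonal_to_eigenspaces[OF A sym])
    fix \<mu> w assume w: "w \<in> eigenspace A \<mu>"
    note wc = eigenspaceD[OF w A]
    show "(x - s) \<bullet> w = 0"
    proof (cases "eigenvalue A \<mu>")
      case True
      have "w \<bullet> s = (\<Sum>\<theta>\<in>?S. w \<bullet> ?E \<theta>)" unfolding s_def by (rule scalar_prod_vec_sum[OF E(1)])
      also have "\<dots> = (\<Sum>\<theta>\<in>?S. if \<theta> = \<mu> then w \<bullet> x else 0)"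
        using E(3) eigenspace_orthogonal[OF A sym w E(2)] w by (intro sum.cong) auto
      also have "\<dots> = w \<bullet> x" using True finite_eigenvalues[OF A] by simp
      finally show ?thesis
        using wc x sc comm_scalar_prod[of w n] by (simp add: minus_scalar_prod_distrib[of _ n])
    next
      case False
      then have "w = 0\<^sub>v n" using wc A by (auto simp: eigenvalue_def eigenvector_def)
      then show ?thesis using x sc by simp
    qed
  qed (use x sc in auto)
  then have "s $ i = x $ i" if "i < n" for i
  proof -
    have "(x - s) $ i = 0" using \<open>x - s = 0\<^sub>v n\<close> that by simp
    then show ?thesis using that sc by simp
  qed
  then show ?thesis using x sc unfolding s_def by (intro eq_vecI) auto
qed

section \<open>Products of three sums of simple poles\<close>

text \<open>A rational function in partial fractions, with residue \<open>p x\<close> at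
  \<open>x\<close>. All evaluations below are at points off \<open>X\<close>.\<close>

definition pole_sum :: "real set \<Rightarrow> (real \<Rightarrow> real) \<Rightarrow> real \<Rightarrow> real" where
  "pole_sum X p t = (\<Sum>x\<in>X. p x / (t - x))"

text \<open>The left side is the sum of all residues of the product of the three functions, which
  decays like \<open>1/t^3\<close>. Expanding everything over triples \<open>(x, y, z)\<close>
  reduces the claim to an identity between three fractions.\<close>

lemma pole_sum_triple_product:
  assumes fin: "finite X" "finite Y" "finite Z"
    and disj: "X \<inter> Y = {}" "Y \<inter> Z = {}" "X \<inter> Z = {}"
  shows "(\<Sum>x\<in>X. p x * (pole_sum Y q x * pole_sum Z r x)) +
    (\<Sum>y\<in>Y. q y * (pole_sum X p y * pole_sum Z r y)) +
    (\<Sum>z\<in>Z. r z * (pole_sum X p z * pole_sum Y q z)) = 0"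
proof -
  let ?g = "\<lambda>x y z. p x * q y * r z"
  have X: "(\<Sum>x\<in>X. p x * (pole_sum Y q x * pole_sum Z r x)) =
      (\<Sum>x\<in>X. \<Sum>y\<in>Y. \<Sum>z\<in>Z. ?g x y z * (1 / ((x - y) * (x - z))))"
    unfolding pole_sum_def sum_product unfolding sum_distrib_left
    by (intro sum.cong refl) (simp add: field_simps)
  have "(\<Sum>y\<in>Y. q y * (pole_sum X p y * pole_sum Z r y)) =
      (\<Sum>y\<in>Y. \<Sum>x\<in>X. \<Sum>z\<in>Z. ?g x y z * (1 / ((y - x) * (y - z))))"
    unfolding pole_sum_def sum_product unfolding sum_distrib_left
    by (intro sum.cong refl) (simp add: field_simps)
  also have "\<dots> = (\<Sum>x\<in>X. \<Sum>y\<in>Y. \<Sum>z\<in>Z. ?g x y z * (1 / ((y - x) * (y - z))))"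
    by (rule sum.swap)
  finally have Y: "(\<Sum>y\<in>Y. q y * (pole_sum X p y * pole_sum Z r y)) = \<dots>" .
  have "(\<Sum>z\<in>Z. r z * (pole_sum X p z * pole_sum Y q z)) =
      (\<Sum>z\<in>Z. \<Sum>x\<in>X. \<Sum>y\<in>Y. ?g x y z * (1 / ((z - x) * (z - y))))"
    unfolding pole_sum_def sum_product unfolding sum_distrib_left
    by (intro sum.cong refl) (simp add: field_simps)
  also have "\<dots> = (\<Sum>x\<in>X. \<Sum>z\<in>Z. \<Sum>y\<in>Y. ?g x y z * (1 / ((z - x) * (z - y))))"
    by (rule sum.swap)
  also have "\<dots> = (\<Sum>x\<in>X. \<Sum>y\<in>Y. \<Sum>z\<in>Z. ?g x y z * (1 / ((z - x) * (z - y))))"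
    by (intro sum.cong refl sum.swap)
  finally have Z: "(\<Sum>z\<in>Z. r z * (pole_sum X p z * pole_sum Y q z)) = \<dots>" .
  have "?g x y z * (1 / ((x - y) * (x - z))) + ?g x y z * (1 / ((y - x) * (y - z))) +
      ?g x y z * (1 / ((z - x) * (z - y))) = 0"
    if "x \<in> X" "y \<in> Y" "z \<in> Z" for x y z
  proof -
    have ne: "x - y \<noteq> 0" "x - z \<noteq> 0" "y - z \<noteq> 0" using disj that by auto
    \<comment> \<open>Over this common denominator the numerators are \<open>y - z\<close>,
      \<open>z - x\<close> and \<open>x - y\<close>, which add up to zero.\<close>
    let ?d = "(x - y) * (x - z) * (y - z)"
    have e: "1 / ((x - y) * (x - z)) = (y - z) / ?d" "1 / ((y - x) * (y - z)) = (z - x) / ?d"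
      "1 / ((z - x) * (z - y)) = (x - y) / ?d"
      using ne by (auto simp: divide_simps) (auto simp: algebra_simps)
    have "1 / ((x - y) * (x - z)) + 1 / ((y - x) * (y - z)) + 1 / ((z - x) * (z - y)) = 0"
      unfolding e add_divide_distrib[symmetric] by simp
    then show ?thesis by (simp only: distrib_left[symmetric] mult_zero_right)
  qed
  then show ?thesis
    unfolding X Y Z by (simp flip: sum.distrib)
qed

text \<open>The hypotheses say that at a pole of one of the three sums the other two agree, so the
  residues of the product of the three sums are non-negative; their sum is zero.\<close>

lemma no_three_pole_sums:
  assumes fin: "finite X" "finite Y" "finite Z"
    and disj: "X \<inter> Y = {}" "Y \<inter> Z = {}" "X \<inter> Z = {}"
    and ne: "X \<noteq> {}" "Y \<noteq> {}" "Z \<noteq> {}"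
    and pos: "\<And>x. x \<in> X \<Longrightarrow> p x > 0" "\<And>y. y \<in> Y \<Longrightarrow> q y > 0"
      "\<And>z. z \<in> Z \<Longrightarrow> r z > 0"
    and eq: "\<And>x. x \<in> X \<Longrightarrow> pole_sum Y q x = pole_sum Z r x"
      "\<And>y. y \<in> Y \<Longrightarrow> pole_sum X p y = pole_sum Z r y"
      "\<And>z. z \<in> Z \<Longrightarrow> pole_sum X p z = pole_sum Y q z"
  shows False
proof -
  let ?x = "\<lambda>x. p x * (pole_sum Y q x)\<^sup>2" and ?y = "\<lambda>y. q y * (pole_sum X p y)\<^sup>2"
    and ?z = "\<lambda>z. r z * (pole_sum X p z)\<^sup>2"
  have nn: "\<And>x. x \<in> X \<Longrightarrow> ?x x \<ge> 0" "\<And>y. y \<in> Y \<Longrightarrow> ?y y \<ge> 0"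
    "\<And>z. z \<in> Z \<Longrightarrow> ?z z \<ge> 0"
    using pos by (auto simp: less_imp_le)
  have "sum ?x X + sum ?y Y + sum ?z Z = 0"
    using pole_sum_triple_product[OF fin disj, of p q r] by (simp add: eq power2_eq_square)
  moreover have "sum ?x X \<ge> 0" "sum ?y Y \<ge> 0" "sum ?z Z \<ge> 0" using nn by (auto intro: sum_nonneg)
  ultimately have "sum ?x X = 0" "sum ?y Y = 0" "sum ?z Z = 0" by linarith+
  then have "\<forall>x\<in>X. ?x x = 0" "\<forall>y\<in>Y. ?y y = 0" "\<forall>z\<in>Z. ?z z = 0"
    using sum_nonneg_eq_0_iff[OF fin(1) nn(1)] sum_nonneg_eq_0_iff[OF fin(2) nn(2)]
      sum_nonneg_eq_0_iff[OF fin(3) nn(3)] by auto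
  then have zero: "\<And>x. x \<in> X \<Longrightarrow> pole_sum Y q x = 0" "\<And>y. y \<in> Y \<Longrightarrow> pole_sum X p y = 0"
    "\<And>z. z \<in> Z \<Longrightarrow> pole_sum X p z = 0"
    using pos by fastforce+
  have above: "pole_sum W w t > 0"
    if "finite W" "W \<noteq> {}" "\<And>x. x \<in> W \<Longrightarrow> w x > 0" "\<And>x. x \<in> W \<Longrightarrow> x < t" for W w t
    unfolding pole_sum_def using that by (intro sum_pos) auto
  \<comment> \<open>By disjointness the largest pole belongs to one set only, so it lies strictly to
    the right of every pole of the others, where their sums are positive.\<close>
  define m where "m = Max (X \<union> Y \<union> Z)"
  have "m \<in> X \<union> Y \<union> Z" unfolding m_def using fin ne by (intro Max_in) auto
  moreover have le: "x \<le> m" if "x \<in> X \<union> Y \<union> Z" for x unfolding m_def using fin that by simp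
  moreover have lt: "x < m" if "x \<in> X \<union> Y \<union> Z" "x \<noteq> m" for x
    using le[OF that(1)] that(2) by simp
  ultimately consider "m \<in> X" | "m \<in> Y \<union> Z" by blast
  then show False
  proof cases
    case 1
    then have "pole_sum Y q m > 0"
      using disj by (intro above fin ne pos lt) auto
    then show False using zero(1)[OF 1] by simp
  next
    case 2
    then have "pole_sum X p m > 0"
      using disj by (intro above fin ne pos lt) auto
    then show False using zero(2,3) 2 by auto
  qed
qed

section \<open>The quadratic form of the resolvent\<close>

lemma eigenspace_minus:
  assumes "x \<in> eigenspace A \<theta>" "y \<in> eigenspace A \<theta>" and A: "A \<in> carrier_mat n n"
  shows "x - y \<in> eigenspace A \<theta>"
proof -
  note xy = eigenspaceD[OF assms(1) A] eigenspaceD[OF assms(2) A]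
  have "A *\<^sub>v (x - y) = \<theta> \<cdot>\<^sub>v x - \<theta> \<cdot>\<^sub>v y"
    using mult_minus_distrib_mat_vec[OF A xy(1) xy(3)] xy by simp
  also have "\<dots> = \<theta> \<cdot>\<^sub>v (x - y)" using xy by (intro eq_vecI) (auto simp: algebra_simps)
  finally show ?thesis using xy A by (simp add: eigenspace_def)
qed

lemma eigenvalueI_eigenspace:
  assumes "x \<in> eigenspace A \<theta>" "A \<in> carrier_mat n n" "x \<noteq> 0\<^sub>v n"
  shows "eigenvalue A \<theta>"
  using assms by (auto simp: eigenvalue_def eigenvector_def eigenspace_def)

text \<open>Expand \<open>e\<close> spectrally and move \<open>A\<close> across the scalar product.
  The equation only has to be solvable: \<open>\<tau>\<close> may be an eigenvalue of
  \<open>A\<close>, which is how the lemma is applied at poles. The value depends on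
  \<open>e\<close> only through the norms of its projections.\<close>

lemma resolvent_quadratic_form:
  assumes A: "A \<in> carrier_mat n n" and sym: "transpose_mat A = A"
    and x: "x \<in> carrier_vec n" and e: "\<tau> \<cdot>\<^sub>v x - A *\<^sub>v x = e"
  shows "x \<bullet> e = (\<Sum>\<theta> | eigenvalue A \<theta>.
    ((eigenprojection A \<theta> *\<^sub>v e) \<bullet> (eigenprojection A \<theta> *\<^sub>v e)) / (\<tau> - \<theta>))"
proof -
  have ec: "e \<in> carrier_vec n" using x A unfolding e[symmetric] by (intro carrier_vecI) simp
  let ?E = "\<lambda>\<theta>. eigenprojection A \<theta> *\<^sub>v e"
  note E = eigenprojection_props[OF A ec]
  have "x \<bullet> e = x \<bullet> vec_sum n ?E {\<theta>. eigenvalue A \<theta>}"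
    by (simp add: spectral_decomposition[OF A sym ec])
  also have "\<dots> = (\<Sum>\<theta> | eigenvalue A \<theta>. x \<bullet> ?E \<theta>)" by (rule scalar_prod_vec_sum[OF E(1)])
  also have "\<dots> = (\<Sum>\<theta> | eigenvalue A \<theta>. (?E \<theta> \<bullet> ?E \<theta>) / (\<tau> - \<theta>))"
  proof (rule sum.cong)
    fix \<theta>
    let ?w = "?E \<theta>"
    note w = E(1)[of \<theta>] eigenspaceD(2)[OF E(2) A, of \<theta>]
    have Ac: "A *\<^sub>v x \<in> carrier_vec n" using A by (intro carrier_vecI) simp
    have "?w \<bullet> (A *\<^sub>v x) = \<theta> * (?w \<bullet> x)"
      using symmetric_mat_scalar_prod[OF A sym w(1) x] w x by simp
    moreover have "?w \<bullet> e = \<tau> * (?w \<bullet> x) - ?w \<bullet> (A *\<^sub>v x)"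
    proof -
      have "?w \<bullet> e = ?w \<bullet> (\<tau> \<cdot>\<^sub>v x - A *\<^sub>v x)" by (simp only: e)
      also have "\<dots> = ?w \<bullet> (\<tau> \<cdot>\<^sub>v x) - ?w \<bullet> (A *\<^sub>v x)"
        by (rule scalar_prod_minus_distrib) (use w(1) x Ac in auto)
      finally show ?thesis using w(1) x by simp
    qed
    ultimately have "?w \<bullet> ?w = (\<tau> - \<theta>) * (?w \<bullet> x)"
      using E(3)[OF E(2), of \<theta>] by (simp add: algebra_simps)
    \<comment> \<open>This covers \<open>\<tau> = \<theta>\<close>: then \<open>?w\<close> has norm
      zero, and both sides are 0 by the convention for division by zero.\<close>
    moreover have "?w \<bullet> x = 0" if "?w \<bullet> ?w = 0"
      using scalar_prod_self_eq_0[OF w(1) that] x by simp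
    ultimately show "x \<bullet> ?w = (?w \<bullet> ?w) / (\<tau> - \<theta>)"
      using comm_scalar_prod[OF x w(1)] by (cases "\<tau> = \<theta>") (auto simp: field_simps)
  qed simp
  finally show ?thesis .
qed

section \<open>Strongly cospectral vertices in different branches at a cut-vertex\<close>

text \<open>The matrix form of the situation: vertices are row indices, \<open>C a\<close> is the
  branch of \<open>a\<close> after removal of \<open>v\<close>, and \<open>C_closed\<close> says
  that an edge leaving a branch ends at \<open>v\<close>.\<close>

locale cut_branches =
  fixes A :: "real mat" and n v :: nat and I :: "nat set" and C :: "nat \<Rightarrow> nat set"
  assumes A: "A \<in> carrier_mat n n" and sym: "transpose_mat A = A"
    and v: "v < n" and loop: "A $$ (v, v) = 0"
    and I: "a \<in> I \<Longrightarrow> a < n" and C_self: "a \<in> I \<Longrightarrow> a \<in> C a"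
    and v_C: "a \<in> I \<Longrightarrow> v \<notin> C a"
    and C_disjoint: "a \<in> I \<Longrightarrow> b \<in> I \<Longrightarrow> a \<noteq> b \<Longrightarrow> C a \<inter> C b = {}"
    and C_closed: "a \<in> I \<Longrightarrow> p \<in> C a \<Longrightarrow> p < n \<Longrightarrow> q < n \<Longrightarrow> q \<notin> C a \<Longrightarrow> q \<noteq> v \<Longrightarrow>
      A $$ (p, q) = 0"
    and strong: "a \<in> I \<Longrightarrow> b \<in> I \<Longrightarrow> eigenvalue A \<theta> \<Longrightarrow>
      eigenprojection A \<theta> *\<^sub>v unit_vec n a = eigenprojection A \<theta> *\<^sub>v unit_vec n b \<or>
      eigenprojection A \<theta> *\<^sub>v unit_vec n a = - (eigenprojection A \<theta> *\<^sub>v unit_vec n b)"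
begin

text \<open>Zeroing instead of deleting keeps the indices of \<open>A\<close>; the price is the
  extra eigenvector \<open>unit_vec n v\<close> with eigenvalue 0.\<close>

definition B :: "real mat" where
  "B = mat n n (\<lambda>(p, q). if p = v \<or> q = v then 0 else A $$ (p, q))"

definition N :: "real vec" where "N = col A v"

definition restr :: "nat \<Rightarrow> real vec \<Rightarrow> real vec" where
  "restr a x = vec n (\<lambda>m. if m \<in> C a then x $ m else 0)"

definition proj :: "nat \<Rightarrow> real \<Rightarrow> real vec" where
  "proj a \<sigma> = eigenprojection B \<sigma> *\<^sub>v unit_vec n a"

text \<open>The eigenvalues whose eigenspace is not orthogonal to \<open>unit_vec n a\<close>: the
  poles of the diagonal entry at \<open>a\<close> of \<open>(t - B)^-1\<close>.\<close>

definition poles :: "nat \<Rightarrow> real set" where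
  "poles a = {\<sigma>. eigenvalue B \<sigma> \<and> proj a \<sigma> \<noteq> 0\<^sub>v n}"

text \<open>The residue at \<open>\<sigma>\<close> of that diagonal entry.\<close>

definition weight :: "nat \<Rightarrow> real \<Rightarrow> real" where "weight a \<sigma> = proj a \<sigma> $ a"

lemma A_symD: "p < n \<Longrightarrow> q < n \<Longrightarrow> A $$ (p, q) = A $$ (q, p)"
  using A sym by (metis carrier_matD index_transpose_mat(1))

lemma B: "B \<in> carrier_mat n n" by (simp add: B_def)

lemma B_sym: "transpose_mat B = B"
  by (rule eq_matI) (auto simp: B_def A_symD)

lemma N: "N \<in> carrier_vec n" using A by (simp add: N_def carrier_vecI)

lemma restr: "restr a x \<in> carrier_vec n" by (simp add: restr_def)

lemma index_restr: "m < n \<Longrightarrow> restr a x $ m = (if m \<in> C a then x $ m else 0)"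
  by (simp add: restr_def)

text \<open>The matrices differ only in row and column \<open>v\<close>. The column meets the zero
  entry of \<open>x\<close>, and the row contributes \<open>N \<bullet> x\<close> at
  \<open>v\<close>.\<close>

lemma A_mult_vec:
  assumes x: "x \<in> carrier_vec n" and xv: "x $ v = 0"
  shows "A *\<^sub>v x = B *\<^sub>v x + (N \<bullet> x) \<cdot>\<^sub>v unit_vec n v"
proof (rule eq_vecI)
  fix m assume "m < dim_vec (B *\<^sub>v x + (N \<bullet> x) \<cdot>\<^sub>v unit_vec n v)"
  then have m: "m < n" by simp
  show "(A *\<^sub>v x) $ m = (B *\<^sub>v x + (N \<bullet> x) \<cdot>\<^sub>v unit_vec n v) $ m"
  proof (cases "m = v")
    case True
    have "(A *\<^sub>v x) $ v = N \<bullet> x"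
      using A x v by (auto simp: scalar_prod_def N_def A_symD intro!: sum.cong)
    moreover have "(B *\<^sub>v x) $ v = 0" using v x by (simp add: B_def scalar_prod_def)
    ultimately show ?thesis using v B True by simp
  next
    case False
    have "(A *\<^sub>v x) $ m = (B *\<^sub>v x) $ m"
      using A x m v xv False by (auto simp: scalar_prod_def B_def intro!: sum.cong)
    then show ?thesis using m v B False by simp
  qed
qed (use A in auto)

text \<open>No nonzero entry of \<open>B\<close> joins a branch to its complement, since the only
  possible link, through \<open>v\<close>, has been zeroed.\<close>

lemma B_restr:
  assumes a: "a \<in> I" and x: "x \<in> carrier_vec n"
  shows "B *\<^sub>v restr a x = restr a (B *\<^sub>v x)"
proof (rule eq_vecI)
  fix m assume "m < dim_vec (restr a (B *\<^sub>v x))"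
  then have m: "m < n" by (simp add: restr_def)
  have z: "B $$ (m, q) = 0" if "m \<in> C a \<longleftrightarrow> q \<notin> C a" "q < n" for q
    using that m C_closed[OF a, of m q] C_closed[OF a, of q m]
    by (cases "m \<in> C a") (auto simp: B_def A_symD[of m q])
  show "(B *\<^sub>v restr a x) $ m = restr a (B *\<^sub>v x) $ m"
    using m x B z by (auto simp: scalar_prod_def restr_def intro!: sum.cong sum.neutral)
qed (auto simp: B_def restr_def)

lemma restr_scalar_prod:
  assumes "x \<in> carrier_vec n" "y \<in> carrier_vec n"
  shows "restr a x \<bullet> y = x \<bullet> restr a y"
  using assms by (auto simp: scalar_prod_def restr_def intro!: sum.cong)

lemma restr_unit: "a \<in> I \<Longrightarrow> restr a (unit_vec n a) = unit_vec n a"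
  by (rule eq_vecI) (auto simp: restr_def C_self I unit_vec_def)

lemma restr_eigenspace:
  assumes "a \<in> I" "x \<in> eigenspace B \<sigma>"
  shows "restr a x \<in> eigenspace B \<sigma>"
  using eigenspaceD[OF assms(2) B] B_restr[OF assms(1)] B
  by (auto simp: eigenspace_def restr_def intro!: eq_vecI)

text \<open>Restriction to the branch is self-adjoint, preserves eigenspaces of \<open>B\<close> and
  fixes \<open>unit_vec n a\<close>. So the projection and its restriction pair equally with the
  whole eigenspace; their difference lies in it and is orthogonal to itself.\<close>

lemma restr_proj:
  assumes a: "a \<in> I"
  shows "restr a (proj a \<sigma>) = proj a \<sigma>"
proof -
  let ?w = "proj a \<sigma>"
  have w: "?w \<in> carrier_vec n" "?w \<in> eigenspace B \<sigma>"
    using eigenprojection_props[OF B unit_vec_carrier] by (auto simp: proj_def)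
  have u: "u \<bullet> ?w = u \<bullet> unit_vec n a" if "u \<in> eigenspace B \<sigma>" for u
    using eigenprojection_props(3)[OF B unit_vec_carrier that] by (simp add: proj_def)
  have eq: "u \<bullet> ?w = u \<bullet> restr a ?w" if us: "u \<in> eigenspace B \<sigma>" for u
  proof -
    have uc: "u \<in> carrier_vec n" using eigenspaceD[OF us B] by simp
    have "u \<bullet> restr a ?w = restr a u \<bullet> unit_vec n a"
      using u[OF restr_eigenspace[OF a us]] restr_scalar_prod[OF uc w(1)] by simp
    also have "\<dots> = u \<bullet> unit_vec n a" using restr_scalar_prod[OF uc] restr_unit[OF a] by simp
    finally show ?thesis using u[OF us] by simp
  qed
  let ?d = "?w - restr a ?w"
  have "?d \<in> eigenspace B \<sigma>" using eigenspace_minus[OF w(2) restr_eigenspace[OF a w(2)] B] .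
  from eq[OF this] have "?d \<bullet> ?d = 0"
    using w restr by (simp add: scalar_prod_minus_distrib[of _ n])
  then have d: "?d = 0\<^sub>v n" using w restr by (intro scalar_prod_self_eq_0) auto
  show ?thesis
  proof (rule eq_vecI)
    fix m assume "m < dim_vec ?w"
    then have "m < n" using w by simp
    moreover from this have "?d $ m = 0" by (simp add: d)
    ultimately show "restr a ?w $ m = ?w $ m" using w restr[of a ?w] by simp
  qed (use w in \<open>auto simp: restr_def\<close>)
qed

lemma proj:
  shows "proj a \<sigma> \<in> carrier_vec n" "proj a \<sigma> \<in> eigenspace B \<sigma>"
    and "B *\<^sub>v proj a \<sigma> = \<sigma> \<cdot>\<^sub>v proj a \<sigma>"
  using eigenprojection_props(1,2)[OF B unit_vec_carrier] eigenspaceD(2)[OF _ B]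
  by (auto simp: proj_def)

lemma proj_outside: "a \<in> I \<Longrightarrow> m < n \<Longrightarrow> m \<notin> C a \<Longrightarrow> proj a \<sigma> $ m = 0"
  using index_restr[of m a "proj a \<sigma>"] by (simp add: restr_proj)

lemma not_in_other: "a \<in> I \<Longrightarrow> b \<in> I \<Longrightarrow> a \<noteq> b \<Longrightarrow> b \<notin> C a"
  using C_disjoint C_self by blast

text \<open>Testing the projection against itself shows that the weight is the squared norm of
  \<open>proj a \<sigma>\<close>.\<close>

lemma weight_pos:
  assumes "a \<in> I" "\<sigma> \<in> poles a"
  shows "weight a \<sigma> > 0"
proof -
  have "proj a \<sigma> \<bullet> proj a \<sigma> = weight a \<sigma>"
    using eigenprojection_props(3)[OF B unit_vec_carrier proj(2)] proj(1) I[OF assms(1)]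
    by (simp add: proj_def weight_def)
  moreover have "proj a \<sigma> \<bullet> proj a \<sigma> \<noteq> 0"
    using scalar_prod_self_eq_0[OF proj(1)] assms(2) by (auto simp: poles_def)
  moreover have "proj a \<sigma> \<bullet> proj a \<sigma> \<ge> 0" by (auto simp: scalar_prod_def sum_nonneg)
  ultimately show ?thesis by simp
qed

text \<open>An entry of \<open>u\<close> at a vertex is its scalar product with the projected unit
  vector, and these projections agree up to sign.\<close>

lemma eigenvector_entries:
  assumes ab: "a \<in> I" "b \<in> I" and u: "u \<in> eigenspace A \<theta>"
  shows "\<bar>u $ a\<bar> = \<bar>u $ b\<bar>"
proof (cases "u = 0\<^sub>v n")
  case True
  then show ?thesis using ab I by simp
next
  case False
  have uc: "u \<in> carrier_vec n" using eigenspaceD(1)[OF u A] .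
  have entry: "u $ c = u \<bullet> (eigenprojection A \<theta> *\<^sub>v unit_vec n c)" if "c \<in> I" for c
    using eigenprojection_props(3)[OF A unit_vec_carrier u] uc I[OF that] by simp
  define e where "e = eigenprojection A \<theta> *\<^sub>v unit_vec n b"
  have "e \<in> carrier_vec n"
    using eigenprojection_props(1)[OF A unit_vec_carrier] by (simp add: e_def)
  then have "u \<bullet> (- e) = - (u \<bullet> e)" using uc by simp
  then show ?thesis
    using strong[OF ab eigenvalueI_eigenspace[OF u A False]]
    by (auto simp: entry[OF ab(1)] entry[OF ab(2)] simp flip: e_def)
qed

section \<open>Poles of the branches\<close>

lemma finite_poles: "finite (poles a)"
  using finite_eigenvalues[OF B] by (auto simp: poles_def)

lemma sum_proj: "m < n \<Longrightarrow> (\<Sum>\<sigma>\<in>poles a. proj a \<sigma> $ m) = unit_vec n a $ m"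
proof -
  assume m: "m < n"
  have "(\<Sum>\<sigma>\<in>poles a. proj a \<sigma> $ m) = (\<Sum>\<sigma> | eigenvalue B \<sigma>. proj a \<sigma> $ m)"
    using m by (intro sum.mono_neutral_left finite_eigenvalues[OF B]) (auto simp: poles_def)
  also have "\<dots> = unit_vec n a $ m"
    using arg_cong[OF spectral_decomposition[OF B B_sym unit_vec_carrier[of n a]],
        of "\<lambda>u. u $ m"] m
    by (simp add: proj_def)
  finally show ?thesis .
qed

lemma poles_nonempty: "a \<in> I \<Longrightarrow> poles a \<noteq> {}"
  using sum_proj[of a a] I by fastforce

lemma A_proj:
  assumes "a \<in> I"
  shows "A *\<^sub>v proj a \<sigma> = \<sigma> \<cdot>\<^sub>v proj a \<sigma> + (N \<bullet> proj a \<sigma>) \<cdot>\<^sub>v unit_vec n v"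
  using A_mult_vec[OF proj(1)] proj(3) proj_outside[OF assms v v_C[OF assms]] by simp

text \<open>Otherwise \<open>proj a \<tau>\<close> would be an eigenvector of \<open>A\<close> that
  vanishes at \<open>b\<close> but not at \<open>a\<close>.\<close>

lemma N_proj_nonzero:
  assumes ab: "a \<in> I" "b \<in> I" "a \<noteq> b" and \<tau>: "\<tau> \<in> poles a"
  shows "N \<bullet> proj a \<tau> \<noteq> 0"
proof
  assume "N \<bullet> proj a \<tau> = 0"
  then have "A *\<^sub>v proj a \<tau> = \<tau> \<cdot>\<^sub>v proj a \<tau>"
    using A_proj[OF ab(1)] proj(1)[of a \<tau>] by (auto intro!: eq_vecI)
  then have "proj a \<tau> \<in> eigenspace A \<tau>" using proj(1) A by (simp add: eigenspace_def)
  from eigenvector_entries[OF ab(1,2) this] have "proj a \<tau> $ a = 0"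
    using proj_outside[OF ab(1) I[OF ab(2)] not_in_other[OF ab]] by simp
  then show False using weight_pos[OF ab(1) \<tau>] by (simp add: weight_def)
qed

text \<open>A common pole would give an eigenvector of \<open>A\<close>, supported on two branches, that vanishes
  at \<open>c\<close> but not at \<open>a\<close>.\<close>

lemma poles_disjoint:
  assumes I3: "a \<in> I" "b \<in> I" "c \<in> I" "distinct [a, b, c]"
  shows "poles a \<inter> poles b = {}"
proof (rule ccontr)
  assume "poles a \<inter> poles b \<noteq> {}"
  then obtain \<tau> where \<tau>: "\<tau> \<in> poles a" "\<tau> \<in> poles b" by blast
  let ?y = "proj a \<tau>" and ?z = "proj b \<tau>"
  \<comment> \<open>The coefficients make the contributions of the two branches at \<open>v\<close>
    cancel, that is \<open>N \<bullet> ?u = 0\<close>.\<close>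
  let ?u = "(N \<bullet> ?z) \<cdot>\<^sub>v ?y - (N \<bullet> ?y) \<cdot>\<^sub>v ?z"
  note y = proj(1)[of a \<tau>] and z = proj(1)[of b \<tau>]
  have uc: "?u \<in> carrier_vec n" using y z by simp
  have "A *\<^sub>v ?u = (N \<bullet> ?z) \<cdot>\<^sub>v (A *\<^sub>v ?y) - (N \<bullet> ?y) \<cdot>\<^sub>v (A *\<^sub>v ?z)"
    using A y z by (simp add: mult_minus_distrib_mat_vec[OF A] mult_mat_vec[OF A])
  also have "\<dots> = \<tau> \<cdot>\<^sub>v ?u"
    unfolding A_proj[OF I3(1)] A_proj[OF I3(2)] using y z
    by (intro eq_vecI) (auto simp: algebra_simps)
  finally have u: "?u \<in> eigenspace A \<tau>" using uc A by (simp add: eigenspace_def)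
  have "?u $ c = 0"
    using I3 y z I[OF I3(3)] proj_outside not_in_other by simp
  moreover have "?u $ a = (N \<bullet> ?z) * weight a \<tau>"
    using I3 y z I[OF I3(1)] proj_outside[of b a] not_in_other[of b a] by (simp add: weight_def)
  moreover have "(N \<bullet> ?z) * weight a \<tau> \<noteq> 0"
    using weight_pos[OF I3(1) \<tau>(1)] N_proj_nonzero[of b a] I3 \<tau>(2) by auto
  ultimately show False using eigenvector_entries[OF I3(1,3) u] by simp
qed

text \<open>The solution is the spectral expansion of the column of \<open>(\<tau> - B)^-1\<close>
  at \<open>a\<close>. Only poles of \<open>a\<close> occur in it, so it makes sense even when
  \<open>\<tau>\<close> is an eigenvalue of \<open>B\<close> coming from another branch.\<close>

lemma branch_resolvent:
  assumes a: "a \<in> I" and \<tau>: "\<tau> \<notin> poles a"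
  obtains x where "x \<in> carrier_vec n" "\<And>m. m < n \<Longrightarrow> m \<notin> C a \<Longrightarrow> x $ m = 0"
    "\<tau> \<cdot>\<^sub>v x - B *\<^sub>v x = unit_vec n a" "x $ a = pole_sum (poles a) (weight a) \<tau>"
proof
  let ?f = "\<lambda>\<sigma>. (1 / (\<tau> - \<sigma>)) \<cdot>\<^sub>v proj a \<sigma>"
  let ?x = "vec_sum n ?f (poles a)"
  show "?x \<in> carrier_vec n" by simp
  show "?x $ m = 0" if "m < n" "m \<notin> C a" for m
    using that proj(1) proj_outside[OF a] by (simp add: carrier_vecD[OF proj(1)])
  show "?x $ a = pole_sum (poles a) (weight a) \<tau>"
    using I[OF a] by (simp add: pole_sum_def weight_def carrier_vecD[OF proj(1)])
  show "\<tau> \<cdot>\<^sub>v ?x - B *\<^sub>v ?x = unit_vec n a"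
  proof (rule eq_vecI)
    fix m assume "m < dim_vec (unit_vec n a)"
    then have m: "m < n" by simp
    have "B *\<^sub>v ?x = vec_sum n (\<lambda>\<sigma>. B *\<^sub>v ?f \<sigma>) (poles a)"
      using proj(1) by (intro mult_mat_vec_sum[OF B]) simp
    then have "(\<tau> \<cdot>\<^sub>v ?x - B *\<^sub>v ?x) $ m =
        (\<Sum>\<sigma>\<in>poles a. \<tau> * ?f \<sigma> $ m - (B *\<^sub>v ?f \<sigma>) $ m)"
      using m by (simp add: sum_distrib_left sum_subtractf vec_sum_def)
    also have "\<dots> = (\<Sum>\<sigma>\<in>poles a. proj a \<sigma> $ m)"
    proof (rule sum.cong)
      fix \<sigma> assume "\<sigma> \<in> poles a"
      then have "\<tau> - \<sigma> \<noteq> 0" using \<tau> by auto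
      moreover have "(B *\<^sub>v ?f \<sigma>) $ m = \<sigma> / (\<tau> - \<sigma>) * proj a \<sigma> $ m"
        using m mult_mat_vec[OF B proj(1)] proj(3) by (simp add: carrier_vecD[OF proj(1)])
      ultimately show "\<tau> * ?f \<sigma> $ m - (B *\<^sub>v ?f \<sigma>) $ m = proj a \<sigma> $ m"
        using m by (simp add: carrier_vecD[OF proj(1)] field_simps)
    qed simp
    finally show "(\<tau> \<cdot>\<^sub>v ?x - B *\<^sub>v ?x) $ m = unit_vec n a $ m" by (simp only: sum_proj[OF m])
  qed (use B in auto)
qed

text \<open>Both entries are quadratic forms that depend only on the norms of the projected unit
  vectors, and those norms coincide.\<close>

lemma resolvent_diagonal_eq:
  assumes ab: "a \<in> I" "b \<in> I" and x: "x \<in> carrier_vec n" "\<tau> \<cdot>\<^sub>v x - A *\<^sub>v x = unit_vec n a"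
    and y: "y \<in> carrier_vec n" "\<tau> \<cdot>\<^sub>v y - A *\<^sub>v y = unit_vec n b"
  shows "x $ a = y $ b"
proof -
  let ?E = "\<lambda>c \<theta>. eigenprojection A \<theta> *\<^sub>v unit_vec n c"
  have "x $ a = x \<bullet> unit_vec n a" "y $ b = y \<bullet> unit_vec n b" using x y I ab by auto
  moreover have "?E a \<theta> \<bullet> ?E a \<theta> = ?E b \<theta> \<bullet> ?E b \<theta>" if "eigenvalue A \<theta>" for \<theta>
    using strong[OF ab that] eigenprojection_props(1)[OF A unit_vec_carrier, of \<theta> b] by auto
  ultimately show ?thesis
    using resolvent_quadratic_form[OF A sym x] resolvent_quadratic_form[OF A sym y]
    by (auto intro!: sum.cong)
qed

text \<open>At a pole of the branch of \<open>a\<close> the resolvent of the branch of \<open>b\<close> extends to the one of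
  \<open>A\<close>: the defect at \<open>v\<close> is absorbed by the eigenvector \<open>proj a \<tau>\<close>, which vanishes at \<open>b\<close>.\<close>

lemma resolvent_at_pole:
  assumes ab: "a \<in> I" "b \<in> I" "a \<noteq> b" and \<tau>: "\<tau> \<in> poles a" "\<tau> \<notin> poles b"
  obtains x where "x \<in> carrier_vec n" "\<tau> \<cdot>\<^sub>v x - A *\<^sub>v x = unit_vec n b"
    "x $ b = pole_sum (poles b) (weight b) \<tau>"
proof -
  obtain x where x: "x \<in> carrier_vec n" "\<And>m. m < n \<Longrightarrow> m \<notin> C b \<Longrightarrow> x $ m = 0"
    "\<tau> \<cdot>\<^sub>v x - B *\<^sub>v x = unit_vec n b" "x $ b = pole_sum (poles b) (weight b) \<tau>"
    using branch_resolvent[OF ab(2) \<tau>(2)] by metis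
  let ?y = "proj a \<tau>"
  note y = proj(1)[of a \<tau>]
  \<comment> \<open>Chosen to give \<open>N \<bullet> x' = 0\<close>. Subtracting the multiple of
    \<open>proj a \<tau>\<close> does not disturb the equation for \<open>B\<close>, because
    \<open>B\<close> scales that vector by \<open>\<tau>\<close>.\<close>
  define c where "c = (N \<bullet> x) / (N \<bullet> ?y)"
  define x' where "x' = x - c \<cdot>\<^sub>v ?y"
  have c: "c * (N \<bullet> ?y) = N \<bullet> x"
    using N_proj_nonzero[OF ab \<tau>(1)] by (simp add: c_def)
  have Ax: "A *\<^sub>v x = B *\<^sub>v x + (N \<bullet> x) \<cdot>\<^sub>v unit_vec n v"
    using A_mult_vec[OF x(1)] x(2)[OF v v_C[OF ab(2)]] by simp
  have Ax': "A *\<^sub>v x' = A *\<^sub>v x - c \<cdot>\<^sub>v (A *\<^sub>v ?y)"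
    using x(1) y by (simp add: x'_def mult_minus_distrib_mat_vec[OF A] mult_mat_vec[OF A])
  show ?thesis
  proof
    show "x' \<in> carrier_vec n" using x y by (simp add: x'_def)
    show "x' $ b = pole_sum (poles b) (weight b) \<tau>"
      using x y I[OF ab(2)] proj_outside[OF ab(1) I[OF ab(2)] not_in_other[OF ab]]
      by (simp add: x'_def)
    show "\<tau> \<cdot>\<^sub>v x' - A *\<^sub>v x' = unit_vec n b"
    proof (rule eq_vecI)
      fix m assume "m < dim_vec (unit_vec n b)"
      then have m: "m < n" by simp
      have "(\<tau> \<cdot>\<^sub>v x - B *\<^sub>v x) $ m = unit_vec n b $ m" by (simp only: x(3))
      then have "\<tau> * x $ m - (B *\<^sub>v x) $ m = unit_vec n b $ m" using m x(1) B by simp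
      moreover have "(A *\<^sub>v x') $ m = (B *\<^sub>v x) $ m + (N \<bullet> x) * unit_vec n v $ m
          - c * (\<tau> * ?y $ m + (N \<bullet> ?y) * unit_vec n v $ m)"
        unfolding Ax' Ax A_proj[OF ab(1)] using m x(1) y B by (simp del: index_unit_vec(1,2))
      moreover have "c * (\<tau> * ?y $ m + (N \<bullet> ?y) * unit_vec n v $ m)
          = \<tau> * (c * ?y $ m) + (N \<bullet> x) * unit_vec n v $ m"
        by (simp add: algebra_simps flip: c)
      moreover have "(\<tau> \<cdot>\<^sub>v x' - A *\<^sub>v x') $ m = \<tau> * (x $ m - c * ?y $ m) - (A *\<^sub>v x') $ m"
        using m x(1) y A by (simp add: x'_def)
      ultimately show "(\<tau> \<cdot>\<^sub>v x' - A *\<^sub>v x') $ m = unit_vec n b $ m"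
        by (simp only: right_diff_distrib)
    qed (use A in auto)
  qed
qed

text \<open>At a pole of one branch, the values of the other two pole sums are diagonal entries of
  solutions for \<open>A\<close>, hence equal. Disjointness of two pole sets always uses the third
  vertex as a witness.\<close>

theorem no_three_branches:
  assumes I3: "a \<in> I" "b \<in> I" "c \<in> I" "distinct [a, b, c]"
  shows False
proof -
  have agree: "pole_sum (poles y) (weight y) \<tau> = pole_sum (poles z) (weight z) \<tau>"
    if xyz: "x \<in> I" "y \<in> I" "z \<in> I" "distinct [x, y, z]" and \<tau>: "\<tau> \<in> poles x" for x y z \<tau>
  proof -
    have "\<tau> \<notin> poles y" "\<tau> \<notin> poles z"
      using poles_disjoint[of x y z] poles_disjoint[of x z y] xyz \<tau> by auto
    then obtain p q where "p \<in> carrier_vec n" "\<tau> \<cdot>\<^sub>v p - A *\<^sub>v p = unit_vec n y"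
      "p $ y = pole_sum (poles y) (weight y) \<tau>"
      and "q \<in> carrier_vec n" "\<tau> \<cdot>\<^sub>v q - A *\<^sub>v q = unit_vec n z"
      "q $ z = pole_sum (poles z) (weight z) \<tau>"
      using resolvent_at_pole[of x y \<tau>] resolvent_at_pole[of x z \<tau>] xyz \<tau>
      by (metis distinct_length_2_or_more)
    then show ?thesis using resolvent_diagonal_eq[OF xyz(2,3)] by metis
  qed
  show False
    using I3 poles_disjoint[of a b c] poles_disjoint[of b c a] poles_disjoint[of a c b]
    by (intro no_three_pole_sums[of "poles a" "poles b" "poles c" "weight a" "weight b" "weight c"]
        finite_poles poles_nonempty weight_pos agree[of a b c] agree[of b a c] agree[of c a b]) auto
qed

end

section \<open>From the graph to its adjacency matrix\<close>

lemma del_vert_dominates: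
  "u \<rightarrow>\<^bsub>pre_digraph.del_vert G v\<^esub> w \<longleftrightarrow> u \<rightarrow>\<^bsub>G\<^esub> w \<and> u \<noteq> v \<and> w \<noteq> v"
  by (auto simp: arcs_ends_def arc_to_ends_def pre_digraph.del_vert_simps)

text \<open>Both arcs of an edge avoiding \<open>v\<close> survive the deletion, so its ends are
  mutually reachable. This supplies \<open>C_closed\<close>.\<close>

lemma (in graph) adjacent_in_scc_of_del_vert:
  assumes u: "u \<in> pre_digraph.scc_of (del_vert v) a" and uw: "u \<rightarrow>\<^bsub>G\<^esub> w" and w: "w \<noteq> v"
  shows "w \<in> pre_digraph.scc_of (del_vert v) a"
proof -
  interpret H: wf_digraph "del_vert v" by (rule wf_digraph_del_vert)
  have "u \<in> verts (del_vert v)"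
    using u by (auto simp: H.scc_of_def dest: H.reachable_in_verts)
  then have "u \<noteq> v" by (simp add: verts_del_vert)
  moreover have "w \<rightarrow>\<^bsub>G\<^esub> u" using uw by (rule graph_symmetric)
  ultimately have "u \<rightarrow>\<^bsub>del_vert v\<^esub> w" "w \<rightarrow>\<^bsub>del_vert v\<^esub> u"
    using uw w by (auto simp: del_vert_dominates)
  then show ?thesis
    using u H.reachable_adjI H.reachable_trans by (auto simp: H.scc_of_def)
qed

lemma (in wf_digraph) scc_of_disjoint:
  assumes "c \<in> sccs" "d \<in> sccs" "c \<noteq> d" "a \<in> verts c" "b \<in> verts d"
  shows "scc_of a \<inter> scc_of b = {}"
proof -
  have "scc_of x = verts e" if e: "e \<in> sccs" and x: "x \<in> verts e" for x e
  proof -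
    have ve: "verts e \<in> sccs_verts" using e by (simp add: sccs_verts_conv)
    have "x \<in> verts G" using sccs_verts_subsets[OF ve] x by auto
    then have "scc_of x \<in> sccs_verts" "x \<in> scc_of x"
      using scc_of_in_sccs_verts in_scc_of_self by auto
    then show ?thesis using sccs_verts_disjoint[OF _ ve] x by blast
  qed
  then show ?thesis using assms scc_disj by simp
qed

lemma char_vec_nth:
  "distinct xs \<Longrightarrow> m < length xs \<Longrightarrow> char_vec xs (xs ! m) = unit_vec (length xs) m"
  by (rule eq_vecI) (auto simp: char_vec_def unit_vec_def nth_eq_iff_index_eq)

theorem theorem7:
  fixes G :: "('a, 'b) pre_digraph" and i j k v :: 'a
  assumes "graph G"
    and "i \<in> verts G" "j \<in> verts G" "k \<in> verts G" "distinct [i, j, k]"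
    and "cospectral G i j" "cospectral G i k" "cospectral G j k"
    and "cut_vertex G v"
    and "\<exists>C1 C2 C3. {C1, C2, C3} \<subseteq> pre_digraph.sccs (pre_digraph.del_vert G v) \<and>
           distinct [C1, C2, C3] \<and> i \<in> verts C1 \<and> j \<in> verts C2 \<and> k \<in> verts C3"
  shows "\<not> strongly_cospectral G i j \<or> \<not> strongly_cospectral G i k \<or> \<not> strongly_cospectral G j k"
proof (rule ccontr)
  assume "\<not> ?thesis"
  then have sc: "strongly_cospectral G i j" "strongly_cospectral G i k" "strongly_cospectral G j k"
    by auto
  interpret graph G by fact
  interpret H: wf_digraph "del_vert v" by (rule wf_digraph_del_vert)
  define xs where "xs = vertex_list G"
  define n where "n = length xs"
  define A where "A = adj_matrix G xs"
  let ?E = "\<lambda>\<theta> m. eigenprojection A \<theta> *\<^sub>v unit_vec n m"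
  have xs: "distinct xs" "set xs = verts G"
    using vertex_list[OF finite_verts] by (auto simp: xs_def)
  have "v \<in> verts G" using assms(9) by (simp add: cut_vertex_def)
  then obtain i' j' k' v' where idx: "i' < n" "j' < n" "k' < n" "v' < n"
    and nth: "xs ! i' = i" "xs ! j' = j" "xs ! k' = k" "xs ! v' = v"
    using assms(2-4) xs(2) unfolding n_def by (metis in_set_conv_nth)
  \<comment> \<open>Vertices are replaced by their positions in the enumeration, and components of
    \<open>del_vert v\<close> by sets of positions.\<close>
  define I where "I = {i', j', k'}"
  define C where "C = (\<lambda>a. {m. m < n \<and> xs ! m \<in> H.scc_of (xs ! a)})"
  have A: "A \<in> carrier_mat n n" by (simp add: A_def adj_matrix_def n_def)
  have A_index: "A $$ (p, q) = (if xs ! p \<rightarrow>\<^bsub>G\<^esub> xs ! q then 1 else 0)" if "p < n" "q < n" for p q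
    using that by (simp add: A_def adj_matrix_def n_def)
  obtain C1 C2 C3 where comps: "{C1, C2, C3} \<subseteq> H.sccs" "distinct [C1, C2, C3]"
    "i \<in> verts C1" "j \<in> verts C2" "k \<in> verts C3"
    using assms(10) by blast
  have scc_disj: "H.scc_of i \<inter> H.scc_of j = {}" "H.scc_of i \<inter> H.scc_of k = {}"
    "H.scc_of j \<inter> H.scc_of k = {}"
    using comps H.scc_of_disjoint[of C1 C2 i j] H.scc_of_disjoint[of C1 C3 i k]
      H.scc_of_disjoint[of C2 C3 j k] by auto
  have in_H: "i \<in> verts (del_vert v)" "j \<in> verts (del_vert v)" "k \<in> verts (del_vert v)"
    using comps by (auto dest!: H.in_sccs_imp_induced subsetD simp: induced_subgraph_altdef)
  have signs: "?E \<theta> a = ?E \<theta> b \<or> ?E \<theta> a = - ?E \<theta> b"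
    if "strongly_cospectral G (xs ! a) (xs ! b)" "a < n" "b < n" "eigenvalue A \<theta>" for a b \<theta>
    using that char_vec_nth[OF xs(1)]
    by (auto simp: strongly_cospectral_def Let_def A_def n_def simp flip: xs_def)
  interpret cut_branches A n v' I C
  proof
    show "transpose_mat A = A"
      using A by (intro eq_matI) (auto simp: A_index dest: graph_symmetric)
    show "A $$ (v', v') = 0" using idx by (auto simp: A_index dest: adj_not_same)
    show "a \<in> C a" if "a \<in> I" for a
      using that idx in_H H.in_scc_of_self by (auto simp: I_def C_def nth)
    show "v' \<notin> C a" if "a \<in> I" for a
      by (auto simp: C_def nth H.scc_of_def verts_del_vert dest!: H.reachable_in_verts)
    show "C a \<inter> C b = {}" if "a \<in> I" "b \<in> I" "a \<noteq> b" for a b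
      using that scc_disj by (auto simp: I_def C_def nth)
    show "A $$ (p, q) = 0"
      if "a \<in> I" "p \<in> C a" "p < n" "q < n" "q \<notin> C a" "q \<noteq> v'" for a p q
    proof -
      have "xs ! q \<noteq> v" using that idx xs(1) by (auto simp: n_def nth_eq_iff_index_eq simp flip: nth(4))
      then show ?thesis
        using that adjacent_in_scc_of_del_vert[of "xs ! p" v "xs ! a" "xs ! q"]
        by (auto simp: A_index C_def)
    qed
    \<comment> \<open>Equal indices are trivial, and a pair in reverse order follows by exchanging
      the sides, up to negation.\<close>
    show "?E \<theta> a = ?E \<theta> b \<or> ?E \<theta> a = - ?E \<theta> b"
      if "a \<in> I" "b \<in> I" "eigenvalue A \<theta>" for a b \<theta>
      using that signs[of i' j' \<theta>] signs[of i' k' \<theta>] signs[of j' k' \<theta>] sc idx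
      by (auto simp: I_def nth)
  qed (use A idx in \<open>auto simp: I_def\<close>)
  have "distinct [i', j', k']" using assms(5) nth by auto
  then show False using no_three_branches[of i' j' k'] by (simp add: I_def)
qed

end
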